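(* Let $k\ge 2$ be an integer and let $(f_n)_{n\ge 0}$ be a sequence of integers with $f_0=0$, $f_n=\sum_{j=1}^{k} f_{n-j}$ for all $n\ge k+1$, and such that for every $1\le n\le k$ and every choice of signs one has $\sum_{j=1}^n \pm f_j\neq 0$. Let $\mathsf N$ be the set of $w\in\{-1,1\}^{\mathbb N}$ such that $\sum_{j=1}^n f_j w_j=0$ for infinitely many $n\ge1$. Then, with respect to the metric $d(u,v)=\sum_{i=1}^\infty |u_i-v_i|/2^i$ on $\{-1,1\}^{\mathbb N}$, $$\dim_H(\mathsf N)=\dim_P(\mathsf N)=\dim_B(\mathsf N)=\frac{1}{k+1}.$$
   Context: $\mathbb N$ denotes the set of positive integers, and $\mathcal A=\{-1,1\}^{\mathbb N}$ is the space of sequences $w=(w_i)_{i\ge1}$ with $w_i\in\{-1,1\}$, endowed with the metric $d$ given in the claim (a compact metric space). $\dim_H$, $\dim_P$, $\dim_B$ denote respectively the Hausdorff, packing and box-counting dimensions in the metric space $(\mathcal A,d)$. *)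

theory Defs
  imports "HOL-Analysis.Analysis"
begin

section \<open>Fractal dimensions of subsets of a metric space\<close>

subsection \<open>Hausdorff dimension\<close>

text \<open>
  The summand \<open>(diam U)\<^sup>s\<close>, with the usual convention that for \<open>s = 0\<close> it is \<open>1\<close> on nonempty
  sets (\<open>0 powr 0 = 0\<close> in HOL), so that the \<open>0\<close>-dimensional measure is counting measure.
\<close>
definition diam_pow :: "real \<Rightarrow> 'a::metric_space set \<Rightarrow> ennreal" where
  "diam_pow s U =
    (if U = {} then 0 else if s = 0 then 1 else ennreal (diameter U powr s))"

text \<open>The condition \<open>bounded\<close> is needed since \<open>diameter\<close> is unspecified on unbounded sets.\<close>
definition small_set :: "real \<Rightarrow> 'a::metric_space set \<Rightarrow> bool" where
  "small_set \<delta> U \<longleftrightarrow> bounded U \<and> diameter U \<le> \<delta>"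

definition hausdorff_premeasure :: "real \<Rightarrow> real \<Rightarrow> 'a::metric_space set \<Rightarrow> ennreal" where
  "hausdorff_premeasure s \<delta> E =
    (INF U \<in> {U :: nat \<Rightarrow> 'a set. E \<subseteq> (\<Union>i. U i) \<and> (\<forall>i. small_set \<delta> (U i))}.
       \<Sum>i. diam_pow s (U i))"

definition hausdorff_measure :: "real \<Rightarrow> 'a::metric_space set \<Rightarrow> ennreal" where
  "hausdorff_measure s E = (SUP \<delta>\<in>{0<..}. hausdorff_premeasure s \<delta> E)"

definition hausdorff_dim :: "'a::metric_space set \<Rightarrow> ereal" where
  "hausdorff_dim E = Inf {ereal s |s. 0 \<le> s \<and> hausdorff_measure s E = 0}"

subsection \<open>Packing dimension\<close>

text \<open>
  A \<open>\<delta>\<close>-packing of \<open>E\<close> is a countable family of pairwise disjoint closed balls centred in \<open>E\<close>.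
  It is given by pairs (centre, radius), because in a general metric space a ball does not
  determine its radius; a ball of radius \<open>r\<close> contributes \<open>(2r)\<^sup>s\<close>.
\<close>
definition is_packing :: "real \<Rightarrow> 'a::metric_space set \<Rightarrow> ('a \<times> real) set \<Rightarrow> bool" where
  "is_packing \<delta> E P \<longleftrightarrow>
     countable P \<and> P \<subseteq> E \<times> {0<..\<delta>} \<and>
     pairwise (\<lambda>(x, r) (y, t). disjnt (cball x r) (cball y t)) P"

definition packing_premeasure_at :: "real \<Rightarrow> real \<Rightarrow> 'a::metric_space set \<Rightarrow> ennreal" where
  "packing_premeasure_at s \<delta> E =
    (SUP P \<in> {P. is_packing \<delta> E P}. \<Sum>\<^sub>\<infinity>(x, r)\<in>P. ennreal ((2 * r) powr s))"

definition packing_premeasure :: "real \<Rightarrow> 'a::metric_space set \<Rightarrow> ennreal" where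
  "packing_premeasure s E = (INF \<delta>\<in>{0<..}. packing_premeasure_at s \<delta> E)"

text \<open>The packing premeasure is not countably subadditive, hence one further infimum.\<close>
definition packing_measure :: "real \<Rightarrow> 'a::metric_space set \<Rightarrow> ennreal" where
  "packing_measure s E =
    (INF F \<in> {F :: nat \<Rightarrow> 'a set. E \<subseteq> (\<Union>i. F i)}. \<Sum>i. packing_premeasure s (F i))"

definition packing_dim :: "'a::metric_space set \<Rightarrow> ereal" where
  "packing_dim E = Inf {ereal s |s. 0 \<le> s \<and> packing_measure s E = 0}"

subsection \<open>Box-counting dimension\<close>

text \<open>The least number of sets of diameter at most \<open>\<delta>\<close> covering \<open>E\<close>; \<open>\<infinity>\<close> if there is no finite cover.\<close>
definition covering_number :: "real \<Rightarrow> 'a::metric_space set \<Rightarrow> enat" where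
  "covering_number \<delta> E =
    (INF C \<in> {C :: 'a set set. finite C \<and> E \<subseteq> \<Union>C \<and> (\<forall>U\<in>C. small_set \<delta> U)}. enat (card C))"

text \<open>Since \<open>ln 0 = 0\<close> in HOL, the empty set gets box-counting dimension \<open>0\<close>.\<close>
definition box_ratio :: "'a::metric_space set \<Rightarrow> real \<Rightarrow> ereal" where
  "box_ratio E \<delta> =
    (case covering_number \<delta> E of enat m \<Rightarrow> ereal (ln (real m)) | \<infinity> \<Rightarrow> \<infinity>) / ereal (- ln \<delta>)"

definition lower_box_dim :: "'a::metric_space set \<Rightarrow> ereal" where
  "lower_box_dim E = Liminf (at_right 0) (box_ratio E)"

definition upper_box_dim :: "'a::metric_space set \<Rightarrow> ereal" where
  "upper_box_dim E = Limsup (at_right 0) (box_ratio E)"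

text \<open>The box-counting dimension exists iff the lower and upper ones agree.\<close>
definition has_box_dim :: "'a::metric_space set \<Rightarrow> ereal \<Rightarrow> bool" where
  "has_box_dim E a \<longleftrightarrow> lower_box_dim E = a \<and> upper_box_dim E = a"

section \<open>The space of sign sequences\<close>

text \<open>Sequences indexed by the positive integers, as extensional functions on \<open>{1..}\<close>.\<close>
typedef sign_seq = "{1..} \<rightarrow>\<^sub>E {-1, 1} :: (nat \<Rightarrow> int) set"
  morphisms entry Abs_sign_seq
  using PiE_eq_empty_iff[of "{1..}" "\<lambda>_. {-1, 1}"] by blast

lemma entry_cases: "i \<ge> 1 \<Longrightarrow> entry w i = -1 \<or> entry w i = 1"
  using entry[of w] by (auto dest!: PiE_mem[where x = i])

lemma sign_seq_eqI: "(\<And>i. i \<ge> 1 \<Longrightarrow> entry u i = entry v i) \<Longrightarrow> u = v"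
  using entry[of u] entry[of v] by (metis PiE_ext atLeast_iff entry_inject)

lemma summable_sign_dist:
  "summable (\<lambda>i. \<bar>real_of_int (entry u (Suc i) - entry v (Suc i))\<bar> / 2 ^ Suc i)"
proof (rule summable_comparison_test')
  show "summable (\<lambda>i. 2 * (1 / 2 :: real) ^ Suc i)"
    by (intro summable_mult summable_ignore_initial_segment[of _ 1, simplified] summable_geometric) auto
  show "norm (\<bar>real_of_int (entry u (Suc i) - entry v (Suc i))\<bar> / 2 ^ Suc i)
          \<le> 2 * (1 / 2 :: real) ^ Suc i" if "i \<ge> 0" for i
    using entry_cases[of "Suc i" u] entry_cases[of "Suc i" v] by (auto simp: power_one_over)
qed

instantiation sign_seq :: metric_space
begin

text \<open>The sum over \<open>i \<ge> 1\<close> is shifted to a series over all natural numbers.\<close>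
definition dist_sign_seq :: "sign_seq \<Rightarrow> sign_seq \<Rightarrow> real" where
  "dist_sign_seq u v =
    (\<Sum>i. \<bar>real_of_int (entry u (Suc i) - entry v (Suc i))\<bar> / 2 ^ Suc i)"

definition uniformity_sign_seq :: "(sign_seq \<times> sign_seq) filter" where
  "uniformity_sign_seq = (INF e\<in>{0<..}. principal {(u, v). dist u v < e})"

definition open_sign_seq :: "sign_seq set \<Rightarrow> bool" where
  "open_sign_seq S \<longleftrightarrow> (\<forall>u\<in>S. \<forall>\<^sub>F (u', v) in uniformity. u' = u \<longrightarrow> v \<in> S)"

instance
proof
  fix u v w :: sign_seq
  show "dist u v = 0 \<longleftrightarrow> u = v"
  proof
    assume "dist u v = 0"
    then have "\<bar>real_of_int (entry u (Suc i) - entry v (Suc i))\<bar> / 2 ^ Suc i = 0" for i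
      using suminf_eq_zero_iff[OF summable_sign_dist[of u v]]
      unfolding dist_sign_seq_def by auto
    then have "entry u (Suc i) = entry v (Suc i)" for i
      by simp
    then show "u = v"
      by (metis sign_seq_eqI Suc_le_D One_nat_def)
  qed (simp add: dist_sign_seq_def)
  show "dist u v \<le> dist u w + dist v w"
    unfolding dist_sign_seq_def
    by (subst suminf_add[OF summable_sign_dist summable_sign_dist],
        intro suminf_le summable_sign_dist summable_add)
       (auto simp flip: add_divide_distrib intro!: divide_right_mono)
qed (fact uniformity_sign_seq_def open_sign_seq_def)+

end

definition zero_return_set :: "(nat \<Rightarrow> int) \<Rightarrow> sign_seq set" where
  "zero_return_set f = {w. infinite {n. n \<ge> 1 \<and> (\<Sum>j=1..n. f j * entry w j) = 0}}"

end

theory Submission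
  imports Defs
begin

text \<open>
  Write \<open>S n = (\<Sum>j=1..n. f j * w j)\<close> and \<open>D = 1 / (k + 1)\<close>.  The set of zero returns is, up to
  finitely many initial choices, a self-similar set in which every \<open>k + 1\<close> successive signs are
  decided by a single free sign, so, up to a constant factor, \<open>2 powr (D * n)\<close> of the \<open>2 ^ n\<close> words
  of length \<open>n\<close> occur in it.

  The recurrence says that a block of \<open>k\<close> equal signs followed by the opposite sign adds \<open>0\<close> to
  \<open>S\<close>.  Hence every sequence made of such blocks returns to zero infinitely often
  (\<open>block_tail_0_subset_zero_return_set\<close>).  Conversely, far out, a zero of \<open>S\<close> can only occur at the
  end of such a block: if \<open>f\<close> is eventually positive and \<open>2 * f n\<close> eventually exceeds
  \<open>\<bar>f 1\<bar> + \<dots> + \<bar>f (n - 1)\<bar>\<close>, then a wrong sign in the last block leaves a surplus that the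
  earlier terms cannot compensate (\<open>zero_sum_forces_block\<close>).  So each member of the set
  consists of blocks from some position on, and this position is bounded uniformly
  (\<open>zero_return_set_subset_block_tails\<close>).

  That \<open>f\<close> eventually has a constant sign is where integrality enters.  Let \<open>1 / \<theta>\<close> be the root
  greater than \<open>1\<close> of the characteristic polynomial.  After subtracting the right multiple of
  \<open>(1 / \<theta>) ^ n\<close>, each term of the remaining sequence is a convex combination of the preceding \<open>k\<close> terms
  (\<open>averaging\<close>), so it is bounded.  Thus \<open>f n = c * (1 / \<theta>) ^ n + O(1)\<close>, and \<open>c = 0\<close> is impossible: a
  bounded integer sequence of successive averages becomes constant, and that constant would have
  to be \<open>0\<close>, which forces \<open>f 1 = 0\<close> (\<open>zero_if_invariant_zero\<close>).

  The upper bounds for the three dimensions follow from the word count alone (\<open>prefix_growth\<close>).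
  For the lower bounds, the binary digits of \<open>x \<in> {0..<1}\<close> are used as the free signs of a block
  sequence.  A set of diameter \<open>\<delta>\<close> then receives only points \<open>x\<close> from an interval of length at most
  \<open>2 * \<delta> powr D\<close>, so Lebesgue outer measure plays the role of a mass distribution (\<open>coin_mass\<close>).
  It bounds the sums over coverings from below, and also the packing premeasure, because the
  centres of a suitable packing by balls of one radius represent all cylinders of one level.
\<close>

section \<open>Integer sequences in which each term is the sum of the preceding k\<close>

text \<open>
  The index is shifted by one, so that the recurrence holds from the term \<open>k + 1\<close> on and refers only
  to terms with positive index.
\<close>
definition kbonacci :: "nat \<Rightarrow> (nat \<Rightarrow> 'a::comm_monoid_add) \<Rightarrow> bool" where
  "kbonacci k f \<longleftrightarrow> (\<forall>n\<ge>k. f (Suc n) = (\<Sum>i<k. f (n - i)))"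

lemma kbonacciD: "kbonacci k f \<Longrightarrow> n \<ge> k \<Longrightarrow> f (Suc n) = (\<Sum>i<k. f (n - i))"
  by (auto simp: kbonacci_def)

text \<open>
  The number \<open>1 / \<theta>\<close> is the dominant root of \<open>X ^ k - X ^ (k - 1) - \<dots> - 1\<close>.  Its reciprocal is
  more convenient, because the powers of \<open>\<theta>\<close> are themselves the weights of a convex combination.
\<close>
locale kbonacci_root =
  fixes k :: nat and \<theta> :: real
  assumes k_ge_2: "k \<ge> 2" and root_pos: "0 < \<theta>" and root_less_1: "\<theta> < 1"
    and root_eq: "(\<Sum>j=1..k. \<theta> ^ j) = 1"
begin

text \<open>
  These are the coefficients of the quotient of the characteristic polynomial by its linear factor
  \<open>X - 1 / \<theta>\<close>.
\<close>
definition weight :: "nat \<Rightarrow> real" where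
  "weight i = (\<Sum>j=1..k - i. \<theta> ^ j)"

text \<open>
  A left eigenvector of the recurrence: passing from \<open>n\<close> to \<open>n + 1\<close> multiplies it by \<open>1 / \<theta>\<close>.  For a
  solution of the recurrence it measures the coefficient of \<open>(1 / \<theta>) ^ n\<close>.
\<close>
definition invariant :: "(nat \<Rightarrow> real) \<Rightarrow> nat \<Rightarrow> real" where
  "invariant e n = (\<Sum>i<k. weight i * e (n - i))"

lemma weight_diff: "i < k \<Longrightarrow> weight i - weight (Suc i) = \<theta> ^ (k - i)"
proof -
  assume "i < k"
  then obtain m where m: "k - i = Suc m" "k - Suc i = m" by (metis Suc_diff_Suc)
  show ?thesis unfolding weight_def m by simp
qed

lemma weight_step: "i < k \<Longrightarrow> \<theta> * (1 + weight (Suc i)) = weight i"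
proof -
  assume "i < k"
  then obtain m where m: "k - i = Suc m" "k - Suc i = m" by (metis Suc_diff_Suc)
  have "(\<Sum>j=1..Suc m. \<theta> ^ j) = \<theta> + (\<Sum>j=1..m. \<theta> ^ Suc j)"
    by (induction m) auto
  then show ?thesis unfolding weight_def m by (simp add: sum_distrib_left algebra_simps)
qed

lemma weight_pos: "i < k \<Longrightarrow> weight i > 0"
  unfolding weight_def using root_pos by (intro sum_pos) auto

lemma weight_0 [simp]: "weight 0 = 1" and weight_k [simp]: "weight k = 0"
  using root_eq by (auto simp: weight_def)

lemma sum_averaging_weights: "(\<Sum>i<k. \<theta> ^ (k - i)) = 1"
proof -
  have "(\<Sum>i<k. \<theta> ^ (k - i)) = (\<Sum>i<k. \<theta> ^ Suc (k - Suc i))"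
    by (intro sum.cong) (auto simp flip: Suc_diff_Suc)
  also have "\<dots> = (\<Sum>i<k. \<theta> ^ Suc i)"
    by (rule sum.nat_diff_reindex)
  also have "\<dots> = 1"
    using root_eq by (simp add: sum.atLeast1_atMost_eq)
  finally show ?thesis .
qed

lemma invariant_Suc: "invariant e (Suc n) = e (Suc n) + (\<Sum>i<k. weight (Suc i) * e (n - i))"
proof -
  obtain k' where k': "k = Suc k'" using k_ge_2 by (cases k) auto
  have ends: "{..<k} = insert 0 (Suc ` {..<k'})" "{..<k} = insert k' {..<k'}"
    by (simp_all only: k' lessThan_Suc_eq_insert_0[of k', symmetric] lessThan_Suc[of k', symmetric])
  have "invariant e (Suc n) = weight 0 * e (Suc n) + (\<Sum>i<k'. weight (Suc i) * e (n - i))"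
    unfolding invariant_def ends(1) by (subst sum.insert) (auto simp: sum.reindex)
  also have "(\<Sum>i<k'. weight (Suc i) * e (n - i)) = (\<Sum>i<k. weight (Suc i) * e (n - i))"
    unfolding ends(2) using weight_k k' by (subst sum.insert) auto
  finally show ?thesis by simp
qed

lemma invariant_step:
  assumes "kbonacci k e" "n \<ge> k"
  shows "\<theta> * invariant e (Suc n) = invariant e n"
proof -
  have "\<theta> * invariant e (Suc n) = (\<Sum>i<k. \<theta> * (1 + weight (Suc i)) * e (n - i))"
    unfolding invariant_Suc kbonacciD[OF assms]
    by (simp add: sum_distrib_left sum.distrib algebra_simps)
  also have "\<dots> = invariant e n"
    unfolding invariant_def by (intro sum.cong) (simp_all add: weight_step)
  finally show ?thesis .
qed

lemma invariant_zero:
  assumes "kbonacci k e" "invariant e k = 0" "n \<ge> k"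
  shows "invariant e n = 0"
  using assms(3)
proof (induction n rule: dec_induct)
  case (step n)
  then show ?case using invariant_step[OF assms(1), of n] root_pos by auto
qed (fact assms)

text \<open>
  The weights decrease from \<open>1\<close> to \<open>0\<close>, so subtracting two consecutive values of the vanishing
  invariant expresses the new term with the positive coefficients \<open>weight i - weight (i + 1)\<close>,
  whose sum telescopes to \<open>1\<close>.  This replaces the knowledge that the remaining characteristic
  roots lie in the open unit disc.
\<close>
lemma averaging:
  assumes "kbonacci k e" "invariant e k = 0" "n \<ge> k"
  shows "e (Suc n) = (\<Sum>i<k. \<theta> ^ (k - i) * e (n - i))"
proof -
  have "0 = invariant e n - invariant e (Suc n)"
    using invariant_zero[OF assms(1,2)] assms(3) by simp
  also have "\<dots> = (\<Sum>i<k. (weight i - weight (Suc i)) * e (n - i)) - e (Suc n)"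
    unfolding invariant_Suc by (simp add: invariant_def sum_subtractf left_diff_distrib)
  also have "(\<Sum>i<k. (weight i - weight (Suc i)) * e (n - i)) = (\<Sum>i<k. \<theta> ^ (k - i) * e (n - i))"
    by (intro sum.cong) (simp_all add: weight_diff)
  finally show ?thesis by simp
qed

lemma bounded_if_invariant_zero:
  assumes "kbonacci k e" "invariant e k = 0"
  shows "n \<ge> 1 \<Longrightarrow> \<bar>e n\<bar> \<le> (\<Sum>j=1..k. \<bar>e j\<bar>)"
proof (induction n rule: less_induct)
  case (less n)
  show ?case
  proof (cases "n \<le> k")
    case True
    then show ?thesis using less.prems by (intro member_le_sum) auto
  next
    case False
    then obtain m where m: "n = Suc m" "m \<ge> k" by (cases n) auto
    have "\<bar>e n\<bar> \<le> (\<Sum>i<k. \<bar>\<theta> ^ (k - i) * e (m - i)\<bar>)"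
      unfolding m(1) averaging[OF assms m(2)] by (rule sum_abs)
    also have "\<dots> \<le> (\<Sum>i<k. \<theta> ^ (k - i) * (\<Sum>j=1..k. \<bar>e j\<bar>))"
      unfolding abs_mult using less.IH m root_pos
      by (intro sum_mono mult_mono) auto
    also have "\<dots> = (\<Sum>j=1..k. \<bar>e j\<bar>)"
      using sum_averaging_weights by (simp flip: sum_distrib_right)
    finally show ?thesis .
  qed
qed

text \<open>
  The recurrence can be run backwards: the last of the \<open>k\<close> summands is the difference of the sum and
  the other summands.
\<close>
lemma zero_if_window_zero:
  fixes f :: "nat \<Rightarrow> int"
  assumes f: "kbonacci k f" and n: "n \<ge> k" and window: "\<And>i. i < k \<Longrightarrow> f (n - i) = 0"
    and j: "1 \<le> j" "j \<le> n"
  shows "f j = 0"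
  using j
proof (induction "n - j" arbitrary: j rule: less_induct)
  case less
  show ?case
  proof (cases "n - j < k")
    case True
    then show ?thesis using window[of "n - j"] less.prems by simp
  next
    case False
    obtain k' where k': "k = Suc k'" using k_ge_2 by (cases k) auto
    have zero: "f i = 0" if "j < i" "i \<le> n" for i
      using less.hyps[of i] that less.prems by auto
    have "f (Suc (j + k')) = (\<Sum>i<k. f (j + k' - i))"
      using less.prems k' by (intro kbonacciD[OF f]) auto
    also have "\<dots> = f j + (\<Sum>i<k'. f (j + k' - i))"
      unfolding k' by simp
    also have "(\<Sum>i<k'. f (j + k' - i)) = 0"
      using False k' by (intro sum.neutral ballI zero) auto
    also have "f (Suc (j + k')) = 0"
      using False k' by (intro zero) auto
    finally show ?thesis by simp
  qed
qed

text \<open>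
  The sequence takes finitely many values.  Let \<open>M\<close> be the largest value that is taken infinitely
  often.  At a late index with value \<open>M\<close> this value is a weighted average, with positive weights, of
  \<open>k\<close> numbers not exceeding \<open>M\<close>, so all of them equal \<open>M\<close>.  The invariant of this constant window is a
  positive multiple of \<open>M\<close>; hence \<open>M = 0\<close>, and running backwards the whole sequence vanishes.
\<close>
lemma zero_if_invariant_zero:
  fixes f :: "nat \<Rightarrow> int"
  assumes f: "kbonacci k f" and inv: "invariant (\<lambda>n. real_of_int (f n)) k = 0"
  shows "f 1 = 0"
proof -
  let ?e = "\<lambda>n. real_of_int (f n)"
  have e: "kbonacci k ?e"
    using f by (auto simp: kbonacci_def simp flip: of_int_sum)
  define B where "B = \<bar>f 0\<bar> + (\<Sum>j=1..k. \<bar>f j\<bar>)"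
  have "\<bar>f n\<bar> \<le> B" for n
  proof (cases n)
    case (Suc m)
    then have "\<bar>?e n\<bar> \<le> (\<Sum>j=1..k. \<bar>?e j\<bar>)"
      using bounded_if_invariant_zero[OF e inv, of n] by simp
    then have "real_of_int \<bar>f n\<bar> \<le> real_of_int (\<Sum>j=1..k. \<bar>f j\<bar>)"
      by (simp only: of_int_abs of_int_sum)
    then show ?thesis unfolding B_def by linarith
  qed (simp add: B_def sum_nonneg)
  then have "range f \<subseteq> {-B..B}"
    by (auto simp: abs_le_iff minus_le_iff)
  then have fin: "finite (range f)"
    by (rule finite_subset) simp
  define V where "V = {v. infinite {n. f n = v}}"
  have "V \<subseteq> range f"
    unfolding V_def by (auto dest: not_finite_existsD)
  then have finV: "finite V" using fin finite_subset by blast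
  have "V \<noteq> {}"
    using pigeonhole_infinite[of UNIV f] fin by (auto simp: V_def)
  define M where "M = Max V"
  have MV: "M \<in> V" unfolding M_def using finV \<open>V \<noteq> {}\<close> by (rule Max_in)
  have "{n. f n > M} = (\<Union>v\<in>{v\<in>range f. v > M}. {n. f n = v})" by auto
  moreover have "finite {n. f n = v}" if "v > M" for v
    using that Max_ge[OF finV, of v] unfolding M_def V_def by force
  ultimately have "finite {n. f n > M}" using fin by auto
  then obtain N where N: "\<And>n. n \<ge> N \<Longrightarrow> f n \<le> M"
    by (metis (mono_tags, lifting) finite_nat_set_iff_bounded linorder_not_less mem_Collect_eq)
  from MV obtain n' where n': "n' > N + k" "f n' = M"
    unfolding V_def infinite_nat_iff_unbounded by auto
  obtain n where n: "n \<ge> N + k" "f (Suc n) = M"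
    using n' by (intro that[of "n' - 1"]) auto
  have "(\<Sum>i<k. \<theta> ^ (k - i) * (M - f (n - i))) = M * (\<Sum>i<k. \<theta> ^ (k - i)) - ?e (Suc n)"
    using n by (subst averaging[OF e inv])
      (auto simp: right_diff_distrib sum_subtractf sum_distrib_left algebra_simps)
  also have "\<dots> = 0" using n sum_averaging_weights by simp
  finally have "\<forall>i\<in>{..<k}. \<theta> ^ (k - i) * (M - f (n - i)) = 0"
    using N n root_pos by (subst (asm) sum_nonneg_eq_0_iff) auto
  then have const: "f (n - i) = M" if "i < k" for i
    using that root_pos by auto
  have "0 = invariant ?e n"
    using invariant_zero[OF e inv, of n] n by simp
  also have "\<dots> = (\<Sum>i<k. weight i) * M"
    unfolding invariant_def by (simp add: const sum_distrib_right)
  finally have "(\<Sum>i<k. weight i) * M = 0" by simp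
  moreover have "(\<Sum>i<k. weight i) > 0"
    using k_ge_2 by (intro sum_pos weight_pos) (auto simp: lessThan_empty_iff)
  ultimately have "M = 0" by simp
  then show ?thesis
    using zero_if_window_zero[OF f, of n 1] const n k_ge_2 by auto
qed

lemma kbonacci_powers: "kbonacci k (\<lambda>n. (1 / \<theta>) ^ n)"
  unfolding kbonacci_def
proof (intro allI impI)
  fix n assume n: "k \<le> n"
  have "(\<Sum>i<k. (1 / \<theta>) ^ (n - i)) = (\<Sum>i<k. (1 / \<theta>) ^ Suc n * \<theta> ^ Suc i)"
    using n root_pos by (intro sum.cong refl) (simp add: power_diff power_divide field_simps)
  also have "\<dots> = (1 / \<theta>) ^ Suc n * (\<Sum>j=1..k. \<theta> ^ j)"
    by (simp only: sum_distrib_left sum.atLeast1_atMost_eq One_nat_def)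
  finally show "(1 / \<theta>) ^ Suc n = (\<Sum>i<k. (1 / \<theta>) ^ (n - i))"
    unfolding root_eq by simp
qed

text \<open>
  Subtracting the multiple of \<open>(1 / \<theta>) ^ n\<close> that has the same invariant leaves a bounded
  sequence, so the sign of the coefficient \<open>c\<close> decides.
\<close>
lemma eventually_one_sign:
  fixes f :: "nat \<Rightarrow> int"
  assumes f: "kbonacci k f" and "f 1 \<noteq> 0"
  shows "(\<forall>\<^sub>F n in sequentially. f n > 0) \<or> (\<forall>\<^sub>F n in sequentially. f n < 0)"
proof -
  let ?e = "\<lambda>n. real_of_int (f n)"
  let ?p = "\<lambda>n. (1 / \<theta>) ^ n"
  define c where "c = invariant ?e k / invariant ?p k"
  have "invariant ?p k > 0"
    unfolding invariant_def using k_ge_2 root_pos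
    by (intro sum_pos mult_pos_pos weight_pos) (auto simp: lessThan_empty_iff)
  moreover have "invariant ?e k \<noteq> 0"
    using zero_if_invariant_zero[OF f] assms(2) by blast
  ultimately have "c \<noteq> 0" and c: "invariant ?e k - c * invariant ?p k = 0"
    by (auto simp: c_def)
  define r where "r n = ?e n - c * ?p n" for n
  have "kbonacci k r"
    using f kbonacci_powers unfolding r_def kbonacci_def
    by (simp add: sum_subtractf flip: sum_distrib_left)
  moreover have "invariant r k = 0"
    using c unfolding r_def invariant_def
    by (simp add: right_diff_distrib sum_subtractf sum_distrib_left mult.left_commute)
  ultimately have bound: "\<bar>r n\<bar> \<le> (\<Sum>j=1..k. \<bar>r j\<bar>)" if "n \<ge> 1" for n
    using bounded_if_invariant_zero that by blast
  have "filterlim ?p at_top sequentially"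
    using root_pos root_less_1
    by (intro filterlim_at_infinity_imp_filterlim_at_top filterlim_realpow_sequentially_gt1) auto
  then have "\<forall>\<^sub>F n in sequentially. ?p n > (\<Sum>j=1..k. \<bar>r j\<bar>) / \<bar>c\<bar>"
    by (simp add: filterlim_at_top_dense)
  then have ev: "\<forall>\<^sub>F n in sequentially. \<bar>c\<bar> * ?p n > \<bar>?e n - c * ?p n\<bar>"
    using eventually_ge_at_top[of 1]
  proof eventually_elim
    case (elim n)
    then have "\<bar>c\<bar> * ?p n > (\<Sum>j=1..k. \<bar>r j\<bar>)"
      using \<open>c \<noteq> 0\<close> by (simp add: field_simps)
    with bound[OF elim(2)] show ?case unfolding r_def by linarith
  qed
  show ?thesis
  proof (cases "c > 0")
    case True
    from ev have "\<forall>\<^sub>F n in sequentially. f n > 0"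
      by eventually_elim (use True in auto)
    then show ?thesis ..
  next
    case False
    from ev have "\<forall>\<^sub>F n in sequentially. f n < 0"
    proof eventually_elim
      case (elim n)
      have "\<bar>c\<bar> * ?p n = - (c * ?p n)" using False by simp
      with elim have "?e n < 0" by linarith
      then show ?case by simp
    qed
    then show ?thesis ..
  qed
qed

end

lemma ex_kbonacci_root:
  assumes "k \<ge> 2"
  shows "\<exists>\<theta>. kbonacci_root k \<theta>"
proof -
  let ?h = "\<lambda>x::real. \<Sum>j=1..k. x ^ j"
  have "?h 0 = 0" by (intro sum.neutral) auto
  then have "\<exists>x. 0 \<le> x \<and> x \<le> 1 \<and> ?h x = 1"
    using assms by (intro IVT') (auto intro!: continuous_intros)
  then obtain x where x: "0 \<le> x" "x \<le> 1" "?h x = 1" by blast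
  have "x \<noteq> 0" "x \<noteq> 1"
    using x(3) assms \<open>?h 0 = 0\<close> by auto
  with x assms have "kbonacci_root k x" by unfold_locales auto
  then show ?thesis ..
qed

section \<open>Eventual dominance over partial sums\<close>

text \<open>
  By \<open>f (n + 1) = 2 * f n - f (n - k)\<close>, the difference of the two sides grows in each step by
  \<open>f n - 2 * f (n - k)\<close>.  This is eventually at least \<open>1\<close>, since
  \<open>f n \<ge> f (n - 1) + f (n - 2) \<ge> 2 * f (n - 2) + f (n - 3)\<close> and \<open>f (n - 2) \<ge> f (n - k)\<close>.
\<close>
lemma eventually_dominates_partial_sums:
  fixes f :: "nat \<Rightarrow> int"
  assumes k: "k \<ge> 2" and f: "kbonacci k f" and pos: "\<forall>\<^sub>F n in sequentially. f n > 0"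
  shows "\<forall>\<^sub>F n in sequentially. 2 * f n > (\<Sum>j=1..<n. \<bar>f j\<bar>)"
proof -
  from pos obtain N where N: "\<And>n. n \<ge> N \<Longrightarrow> f n > 0"
    by (auto simp: eventually_sequentially)
  define D where "D n = 2 * f n - (\<Sum>j=1..<n. \<bar>f j\<bar>)" for n
  define N1 where "N1 = N + 3 * k + 3"
  obtain k2 where k2: "k = Suc (Suc k2)"
    using k by (intro that[of "k - 2"]) auto
  have rec: "f (Suc n) = f n + f (n - 1) + (\<Sum>i<k2. f (n - Suc (Suc i)))" if "n \<ge> k" for n
    using kbonacciD[OF f that] by (simp only: k2 sum.lessThan_Suc_shift) simp
  have mono1: "f n + f (n - 1) \<le> f (Suc n)" if "n \<ge> N + k" for n
  proof -
    have "(\<Sum>i<k2. f (n - Suc (Suc i))) \<ge> 0"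
      using that k2 by (intro sum_nonneg less_imp_le N) auto
    then show ?thesis using rec[of n] that by simp
  qed
  have mono: "f m \<le> f n" if "N + k \<le> m" "m \<le> n" for m n
    using that(2)
  proof (induction n rule: dec_induct)
    case (step n)
    have "f n \<le> f (Suc n)"
    proof -
      have "n \<ge> N + k" "N \<le> n - 1" using step that(1) k by auto
      then show ?thesis using mono1[of n] N[of "n - 1"] by linarith
    qed
    with step show ?case by simp
  qed simp
  have shift: "f (Suc n) = 2 * f n - f (n - k)" if "n > k" for n
  proof -
    obtain m where m: "n = Suc m" "m \<ge> k" using \<open>n > k\<close> by (cases n) auto
    have "f (Suc n) = f n + (\<Sum>i<Suc k2. f (m - i))"
      using kbonacciD[OF f, of n] that m by (simp add: k2 sum.lessThan_Suc_shift del: sum.lessThan_Suc)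
    moreover have "f n = (\<Sum>i<Suc k2. f (m - i)) + f (n - k)"
      using kbonacciD[OF f m(2)] m(1) by (simp add: k2)
    ultimately show ?thesis by simp
  qed
  have step: "D (Suc n) \<ge> D n + 1" if n: "n \<ge> N1" for n
  proof -
    have "{1..<Suc n} = insert n {1..<n}" using n by (auto simp: N1_def)
    then have "D (Suc n) = D n + 2 * f (Suc n) - 3 * f n"
      unfolding D_def using N[of n] n by (simp add: N1_def)
    also have "\<dots> = D n + f n - 2 * f (n - k)"
      using shift[of n] n by (simp add: N1_def)
    finally have *: "D (Suc n) = D n + f n - 2 * f (n - k)" .
    have "f n \<ge> f (n - 1) + f (n - 2)"
      using mono1[of "n - 1"] n by (simp add: N1_def numeral_2_eq_2 Suc_diff_Suc)
    moreover have "f (n - 1) \<ge> f (n - 2) + f (n - 3)"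
      using mono1[of "n - 2"] n by (simp add: N1_def numeral_2_eq_2 numeral_3_eq_3 Suc_diff_Suc)
    moreover have "f (n - 2) \<ge> f (n - k)" using n k by (intro mono) (auto simp: N1_def)
    moreover have "f (n - 3) \<ge> 1" using N[of "n - 3"] n unfolding N1_def by linarith
    ultimately show ?thesis using * by linarith
  qed
  have grow: "D (N1 + m) \<ge> D N1 + int m" for m
  proof (induction m)
    case (Suc m)
    then show ?case using step[of "N1 + m"] by simp
  qed simp
  have "D n > 0" if "n \<ge> N1 + nat \<bar>D N1\<bar> + 1" for n
    using grow[of "n - N1"] that by simp
  then show ?thesis
    unfolding eventually_sequentially D_def by (metis diff_gt_0_iff_gt)
qed

text \<open>
  Let \<open>m\<close> be the last index before \<open>n\<close>, within the block, whose sign agrees with that of \<open>n\<close>.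
  Expanding \<open>f n\<close> by the recurrence cancels the terms strictly between \<open>m\<close> and \<open>n\<close> and doubles
  \<open>f m\<close>; the partial sum before \<open>m\<close> would have to balance at least \<open>2 * f m\<close>, which is too much.
\<close>
lemma zero_sum_forces_block:
  fixes f w :: "nat \<Rightarrow> int"
  assumes k: "k \<ge> 2" and f: "kbonacci k f"
    and pos: "\<And>n. n \<ge> N \<Longrightarrow> f n > 0"
    and dom: "\<And>n. n \<ge> N \<Longrightarrow> 2 * f n > (\<Sum>j=1..<n. \<bar>f j\<bar>)"
    and signs: "\<And>j. j \<ge> 1 \<Longrightarrow> w j = -1 \<or> w j = 1"
    and n: "n \<ge> N + k + 1" and zero: "(\<Sum>j=1..n. f j * w j) = 0"
    and i: "i \<in> {1..k}"
  shows "w (n - i) = - w n"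
proof (rule ccontr)
  assume "w (n - i) \<noteq> - w n"
  then have ex: "\<exists>i. i \<in> {1..k} \<and> w (n - i) \<noteq> - w n" using i by blast
  \<comment> \<open>the distance from \<open>n\<close> to the last index that violates the claim\<close>
  define l where "l = (LEAST i. i \<in> {1..k} \<and> w (n - i) \<noteq> - w n)"
  have l: "l \<in> {1..k}" "w (n - l) \<noteq> - w n"
    using LeastI_ex[OF ex] unfolding l_def by auto
  have least: "w (n - i) = - w n" if "i \<in> {1..k}" "i < l" for i
    using not_less_Least[of i "\<lambda>i. i \<in> {1..k} \<and> w (n - i) \<noteq> - w n"] that unfolding l_def by auto
  define m where "m = n - l"
  have m: "m \<ge> N" "m \<ge> 1" "m < n" "n - k \<le> m" "n - k \<ge> 1" using l n by (auto simp: m_def)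
  have wm: "w m = w n"
    using l(2) signs[of m] signs[of n] m unfolding m_def[symmetric] by auto
  have between: "w j = - w n" if "m < j" "j < n" for j
    using least[of "n - j"] that l by (auto simp: m_def)
  obtain n' where n': "n = Suc n'" "n' \<ge> k" using n by (cases n) auto
  have "f n = (\<Sum>i<k. f (n' - i))"
    unfolding n'(1) by (rule kbonacciD[OF f n'(2)])
  also have "\<dots> = (\<Sum>j=n-k..<n. f j)"
    by (rule sum.reindex_bij_witness[of _ "\<lambda>j. n' - j" "\<lambda>i. n' - i"]) (use n' in auto)
  also have "{n-k..<n} = {n-k..<m} \<union> {m} \<union> {m<..<n}" using m by auto
  also have "(\<Sum>j\<in>\<dots>. f j) = (\<Sum>j=n-k..<m. f j) + f m + (\<Sum>j\<in>{m<..<n}. f j)"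
    by (subst sum.union_disjoint; (subst sum.union_disjoint)?) auto
  finally have fn: "f n = (\<Sum>j=n-k..<m. f j) + f m + (\<Sum>j\<in>{m<..<n}. f j)" .
  have "{1..n} = {1..<m} \<union> {m} \<union> {m<..<n} \<union> {n}" using m by auto
  then have "0 = (\<Sum>j\<in>{1..<m} \<union> {m} \<union> {m<..<n} \<union> {n}. f j * w j)" using zero by simp
  also have "\<dots> = (\<Sum>j=1..<m. f j * w j) + f m * w m + (\<Sum>j\<in>{m<..<n}. f j * w j) + f n * w n"
    using m by (subst sum.union_disjoint; (subst sum.union_disjoint)?; (subst sum.union_disjoint)?) auto
  also have "(\<Sum>j\<in>{m<..<n}. f j * w j) = - (\<Sum>j\<in>{m<..<n}. f j) * w n"
    using between by (simp add: sum_negf sum_distrib_right)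
  finally have "(\<Sum>j=1..<m. f j * w j) = - (2 * f m + (\<Sum>j=n-k..<m. f j)) * w n"
    unfolding wm by (subst (asm) fn) (simp add: algebra_simps)
  moreover have "\<bar>w n\<bar> = 1" using signs[of n] n by auto
  ultimately have "\<bar>2 * f m + (\<Sum>j=n-k..<m. f j)\<bar> = \<bar>\<Sum>j=1..<m. f j * w j\<bar>"
    by (simp add: abs_mult)
  also have "\<dots> \<le> (\<Sum>j=1..<m. \<bar>f j * w j\<bar>)" by (rule sum_abs)
  also have "\<dots> = (\<Sum>j=1..<m. \<bar>f j\<bar>)"
    by (intro sum.cong refl) (use signs in \<open>force simp: abs_mult\<close>)
  also have "\<dots> < 2 * f m" using dom m by blast
  finally have "(\<Sum>j=n-k..<m. f j) < 0" by linarith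
  moreover have "(\<Sum>j=n-k..<m. f j) \<ge> 0"
    using n by (intro sum_nonneg less_imp_le pos) auto
  ultimately show False by simp
qed

section \<open>Prefixes and the metric on sign sequences\<close>

text \<open>
  Made extensional so that two sequences with the same first \<open>n\<close> signs have equal prefixes, and
  cylinders of level \<open>n\<close> can be counted as images.
\<close>
definition prefix :: "nat \<Rightarrow> sign_seq \<Rightarrow> nat \<Rightarrow> int" where
  "prefix n w = restrict (entry w) {1..n}"

lemma prefix_eq_iff: "prefix n u = prefix n v \<longleftrightarrow> (\<forall>i\<in>{1..n}. entry u i = entry v i)"
  by (auto simp: prefix_def restrict_def fun_eq_iff)

lemma dist_le_if_prefix_eq:
  assumes "prefix n u = prefix n v"
  shows "dist u v \<le> 2 / 2 ^ n"
proof -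
  let ?f = "\<lambda>i. \<bar>real_of_int (entry u (Suc i) - entry v (Suc i))\<bar> / 2 ^ Suc i"
  have "dist u v = (\<Sum>i. ?f (i + n)) + (\<Sum>i<n. ?f i)"
    unfolding dist_sign_seq_def by (rule suminf_split_initial_segment[OF summable_sign_dist])
  also have "(\<Sum>i<n. ?f i) = 0"
    using assms by (intro sum.neutral) (auto simp: prefix_eq_iff)
  also have "(\<Sum>i. ?f (i + n)) \<le> (\<Sum>i. 1 / 2 ^ n * (1 / 2) ^ i)"
  proof (rule suminf_le)
    show "?f (i + n) \<le> 1 / 2 ^ n * (1 / 2) ^ i" for i
      using entry_cases[of "Suc (i + n)" u] entry_cases[of "Suc (i + n)" v]
      by (auto simp: power_one_over power_add mult.commute)
    show "summable (\<lambda>i. ?f (i + n))"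
      by (rule summable_ignore_initial_segment[OF summable_sign_dist])
    show "summable (\<lambda>i. 1 / 2 ^ n * (1 / 2 :: real) ^ i)"
      by (intro summable_mult summable_geometric) auto
  qed
  also have "\<dots> = 2 / 2 ^ n"
    by (subst suminf_mult) (auto intro!: summable_geometric simp: suminf_geometric)
  finally show ?thesis by simp
qed

lemma prefix_eq_if_dist_less:
  assumes "dist u v < 2 / 2 ^ n"
  shows "prefix n u = prefix n v"
  unfolding prefix_eq_iff
proof (intro ballI, rule ccontr)
  fix i assume i: "i \<in> {1..n}" and neq: "entry u i \<noteq> entry v i"
  let ?f = "\<lambda>i. \<bar>real_of_int (entry u (Suc i) - entry v (Suc i))\<bar> / 2 ^ Suc i"
  have "2 / 2 ^ n \<le> (2 / 2 ^ i :: real)"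
    using i by (intro divide_left_mono power_increasing) auto
  also have "\<dots> = ?f (i - 1)"
    using entry_cases[of i u] entry_cases[of i v] i neq by auto
  also have "\<dots> = (\<Sum>j\<in>{i - 1}. ?f j)" by simp
  also have "\<dots> \<le> dist u v"
    unfolding dist_sign_seq_def
    by (rule sum_le_suminf[OF summable_sign_dist]) auto
  finally show False using assms by simp
qed

lemma entry_in_signs: "i \<ge> 1 \<Longrightarrow> entry w i \<in> {-1, 1}"
  using entry_cases[of i w] by auto

lemma finite_prefixes: "finite (prefix n ` S)"
proof (rule finite_subset)
  show "prefix n ` S \<subseteq> {1..n} \<rightarrow>\<^sub>E {-1, 1}"
    unfolding prefix_def
    by (intro image_subsetI restrict_PiE_iff[THEN iffD2] ballI entry_in_signs) auto
qed (auto intro: finite_PiE)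

lemma small_set_prefix_class: "small_set (2 / 2 ^ n) {w \<in> S. prefix n w = x}"
proof -
  let ?U = "{w \<in> S. prefix n w = x}"
  have d: "dist u v \<le> 2 / 2 ^ n" if "u \<in> ?U" "v \<in> ?U" for u v
    using that by (intro dist_le_if_prefix_eq) auto
  then have "bounded ?U"
    unfolding bounded_def by (cases "?U = {}") blast+
  moreover have "diameter ?U \<le> 2 / 2 ^ n"
  proof (cases "?U = {}")
    case False
    then show ?thesis unfolding diameter_def using d
      by (auto intro!: cSUP_least)
  next
    case True
    show ?thesis unfolding True diameter_def by simp
  qed
  ultimately show ?thesis by (simp add: small_set_def)
qed

lemma small_set_subset_prefix_class:
  assumes "small_set \<delta> U" "\<delta> < 2 / 2 ^ n" "u \<in> U" "v \<in> U"
  shows "prefix n u = prefix n v"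
  using assms diameter_bounded_bound[of U u v]
  by (intro prefix_eq_if_dist_less) (auto simp: small_set_def)

text \<open>
  The cylinder level that belongs to a given radius: two points with the same \<open>n + 1\<close> first signs are
  within \<open>r\<close>, and points at distance at most \<open>r\<close> have the same \<open>n\<close> first signs.
\<close>
lemma dyadic_scale:
  fixes r :: real
  assumes "0 < r" "r \<le> 1"
  shows "\<exists>n. 1 / 2 ^ n \<le> r \<and> r < 2 / 2 ^ n"
proof -
  obtain n0 where "(1 / 2) ^ n0 < r" using real_arch_pow_inv[of r "1 / 2"] assms by auto
  then have ex: "1 / 2 ^ n0 \<le> r" by (simp add: power_one_over)
  define n where "n = (LEAST n. 1 / 2 ^ n \<le> r)"
  have "1 / 2 ^ n \<le> r" unfolding n_def by (rule LeastI[of "\<lambda>n. 1 / 2 ^ n \<le> r", OF ex])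
  moreover have "r < 2 / 2 ^ n"
  proof (cases n)
    case 0
    then show ?thesis using assms by simp
  next
    case (Suc m)
    then have "\<not> 1 / 2 ^ m \<le> r" using not_less_Least[of m "\<lambda>n. 1 / 2 ^ n \<le> r"] unfolding n_def by simp
    then show ?thesis using Suc by simp
  qed
  ultimately show ?thesis by blast
qed

section \<open>Zero returns and block sequences\<close>

text \<open>
  From position \<open>p\<close> on, the sequence consists of blocks of length \<open>k + 1\<close> in which the last sign is
  opposite to all others; the \<open>p\<close> initial signs are arbitrary.
\<close>
definition block_tail :: "nat \<Rightarrow> nat \<Rightarrow> sign_seq set" where
  "block_tail k p =
    {w. \<forall>i. \<forall>j\<in>{1..k}. entry w (p + (k + 1) * i + j) = - entry w (p + (k + 1) * i + k + 1)}"

lemma block_tailD: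
  "w \<in> block_tail k p \<Longrightarrow> j \<in> {1..k} \<Longrightarrow>
    entry w (p + (k + 1) * i + j) = - entry w (p + (k + 1) * i + k + 1)"
  unfolding block_tail_def by blast

lemma block_contributes_zero:
  fixes f w :: "nat \<Rightarrow> int"
  assumes f: "kbonacci k f" and block: "\<And>j. j \<in> {1..k} \<Longrightarrow> w (p + j) = - w (p + k + 1)"
  shows "(\<Sum>j=1..p + k + 1. f j * w j) = (\<Sum>j=1..p. f j * w j)"
proof -
  have "f (Suc (p + k)) = (\<Sum>i<k. f (p + k - i))"
    by (rule kbonacciD[OF f]) simp
  also have "\<dots> = (\<Sum>j\<in>{p<..p + k}. f j)"
    by (rule sum.reindex_bij_witness[of _ "\<lambda>j. p + k - j" "\<lambda>i. p + k - i"]) auto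
  finally have fn: "f (p + k + 1) = (\<Sum>j\<in>{p<..p + k}. f j)" by simp
  have "{1..p + k + 1} = {1..p} \<union> {p<..p + k} \<union> {p + k + 1}" by auto
  then have "(\<Sum>j=1..p + k + 1. f j * w j)
    = (\<Sum>j=1..p. f j * w j) + (\<Sum>j\<in>{p<..p + k}. f j * w j) + f (p + k + 1) * w (p + k + 1)"
    by (simp add: sum.union_disjoint disjoint_iff)
  moreover have "(\<Sum>j\<in>{p<..p + k}. f j * w j) = (\<Sum>j\<in>{p<..p + k}. f j * (- w (p + k + 1)))"
  proof (intro sum.cong refl)
    fix j assume "j \<in> {p<..p + k}"
    then have "j - p \<in> {1..k}" "p + (j - p) = j" by auto
    then show "f j * w j = f j * (- w (p + k + 1))"
      using block[of "j - p"] by simp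
  qed
  ultimately show ?thesis unfolding fn
    by (simp add: sum_negf flip: sum_distrib_right)
qed

lemma block_tail_0_subset_zero_return_set:
  assumes f: "kbonacci k f"
  shows "block_tail k 0 \<subseteq> zero_return_set f"
proof
  fix w assume w: "w \<in> block_tail k 0"
  have zero: "(\<Sum>j=1..(k + 1) * i. f j * entry w j) = 0" for i
  proof (induction i)
    case (Suc i)
    have "(\<Sum>j=1..(k + 1) * i + k + 1. f j * entry w j) = (\<Sum>j=1..(k + 1) * i. f j * entry w j)"
      using block_tailD[OF w] by (intro block_contributes_zero[OF f]) (simp only: add_0)
    with Suc show ?case by (simp add: algebra_simps)
  qed simp
  have "infinite (range (\<lambda>i. (k + 1) * Suc i))"
    by (intro range_inj_infinite injI) (simp only: mult_cancel1, simp)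
  moreover have "range (\<lambda>i. (k + 1) * Suc i) \<subseteq> {n. n \<ge> 1 \<and> (\<Sum>j=1..n. f j * entry w j) = 0}"
    by (intro image_subsetI CollectI conjI zero) simp
  ultimately show "w \<in> zero_return_set f"
    unfolding zero_return_set_def by (blast dest: infinite_super)
qed

text \<open>
  Every zero of the partial sums far enough out ends a block, at the beginning of which there is
  again a zero.  Infinitely many zeros lie in one residue class modulo \<open>k + 1\<close>, and descending from
  each of them shows that all positions of this class beyond \<open>p\<close> end blocks.
\<close>
lemma zero_return_set_subset_if_pos:
  assumes k: "k \<ge> 2" and f: "kbonacci k f" and "\<forall>\<^sub>F n in sequentially. f n > 0"
  shows "\<exists>P. zero_return_set f \<subseteq> (\<Union>p<P. block_tail k p)"
proof -
  have "\<forall>\<^sub>F n in sequentially. f n > 0 \<and> 2 * f n > (\<Sum>j=1..<n. \<bar>f j\<bar>)"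
    using eventually_dominates_partial_sums[OF assms] assms(3) by eventually_elim simp
  then obtain N where N: "\<And>n. n \<ge> N \<Longrightarrow> f n > 0"
      "\<And>n. n \<ge> N \<Longrightarrow> 2 * f n > (\<Sum>j=1..<n. \<bar>f j\<bar>)"
    by (auto simp: eventually_sequentially)
  define M where "M = N + k + 1"
  have "\<exists>p<(k + 1) * (M + 1). w \<in> block_tail k p" if w: "w \<in> zero_return_set f" for w
  proof -
    define zero where "zero n \<longleftrightarrow> (\<Sum>j=1..n. f j * entry w j) = 0" for n
    have block: "entry w (n + j) = - entry w (n + k + 1)" if "zero (n + k + 1)" "n \<ge> M" "j \<in> {1..k}" for n j
    proof -
      have "entry w (n + k + 1 - (k + 1 - j)) = - entry w (n + k + 1)"
        using that
        by (intro zero_sum_forces_block[OF k f, of N] N entry_cases) (auto simp: zero_def M_def)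
      moreover have "n + k + 1 - (k + 1 - j) = n + j" using that(3) by auto
      ultimately show ?thesis by simp
    qed
    have "infinite {n. zero n}"
      using w unfolding zero_return_set_def zero_def by (auto elim!: infinite_super[rotated])
    moreover have "finite ((\<lambda>n. n mod (k + 1)) ` {n. zero n})"
      by (rule finite_subset[of _ "{..k}"]) (auto simp: less_Suc_eq_le[symmetric])
    ultimately obtain r where inf: "infinite {n. zero n \<and> n mod (k + 1) = r mod (k + 1)}"
      using pigeonhole_infinite[of "{n. zero n}" "\<lambda>n. n mod (k + 1)"] by auto
    \<comment> \<open>a representative of the class that is at least \<open>M\<close> and bounded independently of \<open>w\<close>\<close>
    define p where "p = r mod (k + 1) + (k + 1) * M"
    have "r mod (k + 1) < k + 1" by simp
    then have "p < (k + 1) * (M + 1)" by (simp add: p_def)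
    moreover have "w \<in> block_tail k p"
      unfolding block_tail_def
    proof (intro CollectI allI ballI)
      fix i j assume j: "j \<in> {1..k}"
      obtain n where n: "n > p + (k + 1) * Suc i" "zero n" "n mod (k + 1) = r mod (k + 1)"
        using inf unfolding infinite_nat_iff_unbounded by blast
      have n': "n = r mod (k + 1) + (k + 1) * (n div (k + 1))"
        using mod_mult_div_eq[of n "k + 1"] unfolding n(3) by (rule sym)
      have "(k + 1) * (M + Suc i) < (k + 1) * (n div (k + 1))"
        using n(1) by (subst (asm) n') (simp add: p_def algebra_simps)
      then have "M + Suc i < n div (k + 1)" by (simp only: mult_less_cancel1)
      then obtain q where "n div (k + 1) = M + q" and q: "q > i"
        by (intro that[of "n div (k + 1) - M"]) auto
      then have nq: "n = p + (k + 1) * q"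
        using n' by (simp add: p_def algebra_simps)
      have "zero (p + (k + 1) * Suc i)"
        using Suc_leI[OF q]
      proof (induction rule: inc_induct)
        case base
        show ?case using n(2) nq by simp
      next
        case (step t)
        let ?n = "p + (k + 1) * t"
        have "?n + k + 1 = p + (k + 1) * Suc t" by simp
        then have "zero (?n + k + 1)" using step.IH by (simp only:)
        moreover have "?n \<ge> M" unfolding p_def by simp
        ultimately have "entry w (?n + j) = - entry w (?n + k + 1)" if "j \<in> {1..k}" for j
          using block that by blast
        then show ?case
          using block_contributes_zero[OF f, of "entry w" ?n] \<open>zero (?n + k + 1)\<close> unfolding zero_def by simp
      qed
      then have "zero (p + (k + 1) * i + k + 1)" by (simp add: algebra_simps)
      moreover have "p + (k + 1) * i \<ge> M" unfolding p_def by simp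
      ultimately have "entry w (p + (k + 1) * i + j) = - entry w (p + (k + 1) * i + k + 1)"
        using j by (intro block)
      then show "entry w (p + (k + 1) * i + j) = - entry w (p + (k + 1) * i + k + 1)" .
    qed
    ultimately show ?thesis by blast
  qed
  then show ?thesis by blast
qed

lemma zero_return_set_uminus: "zero_return_set (\<lambda>n. - f n) = zero_return_set f"
  by (simp add: zero_return_set_def sum_negf)

lemma zero_return_set_subset_block_tails:
  assumes k: "k \<ge> 2" and f: "kbonacci k f" and "f 1 \<noteq> 0"
  shows "\<exists>P. zero_return_set f \<subseteq> (\<Union>p<P. block_tail k p)"
proof -
  obtain \<theta> where "kbonacci_root k \<theta>" using ex_kbonacci_root[OF k] ..
  from kbonacci_root.eventually_one_sign[OF this f \<open>f 1 \<noteq> 0\<close>] show ?thesis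
  proof
    assume "\<forall>\<^sub>F n in sequentially. f n < 0"
    moreover have "kbonacci k (\<lambda>n. - f n)"
      using f by (simp add: kbonacci_def sum_negf)
    ultimately show ?thesis
      using zero_return_set_subset_if_pos[OF k, of "\<lambda>n. - f n"] by (simp add: zero_return_set_uminus)
  qed (rule zero_return_set_subset_if_pos[OF k f])
qed

section \<open>Counting prefixes\<close>

text \<open>
  A prefix of a block sequence is determined by the \<open>p\<close> initial signs together with the last sign of
  each block that meets \<open>{1..n}\<close>.  The final block may end beyond \<open>n\<close>, which accounts for the
  additional factor \<open>2\<close>.
\<close>
lemma card_prefixes_block_tail: "card (prefix n ` block_tail k p) \<le> 2 ^ (p + n div (k + 1) + 1)"
proof -
  define A where "A = {1..p} \<union> (\<lambda>i. p + (k + 1) * i + k + 1) ` {..n div (k + 1)}"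
  define h where "h w = restrict (entry w) A" for w
  have "finite A" unfolding A_def by simp
  have "card A \<le> card {1..p} + card {..n div (k + 1)}"
    unfolding A_def by (rule le_trans[OF card_Un_le add_left_mono[OF card_image_le]]) simp
  then have cardA: "card A \<le> p + n div (k + 1) + 1" by simp
  have hS: "h ` block_tail k p \<subseteq> A \<rightarrow>\<^sub>E {-1, 1}"
    unfolding h_def by (intro image_subsetI restrict_PiE_iff[THEN iffD2] ballI entry_in_signs)
      (auto simp: A_def)
  have finh: "finite (h ` block_tail k p)"
    using finite_subset[OF hS] \<open>finite A\<close> by (auto intro: finite_PiE)
  have det: "prefix n u = prefix n v"
    if uv: "u \<in> block_tail k p" "v \<in> block_tail k p" "h u = h v" for u v
    unfolding prefix_eq_iff
  proof
    fix j assume j: "j \<in> {1..n}"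
    have eqA: "entry u a = entry v a" if "a \<in> A" for a
      using fun_cong[OF uv(3), of a] that by (simp add: h_def)
    show "entry u j = entry v j"
    proof (cases "j \<le> p")
      case True
      then show ?thesis using j by (intro eqA) (simp add: A_def)
    next
      case False
      define i where "i = (j - p - 1) div (k + 1)"
      define l where "l = (j - p - 1) mod (k + 1) + 1"
      have "j - p - 1 = (k + 1) * i + (l - 1)"
        unfolding i_def l_def by (simp only: add_diff_cancel_right' mult_div_mod_eq)
      moreover have l: "l \<ge> 1" "l \<le> k + 1"
        using mod_less_divisor[of "k + 1" "j - p - 1"] unfolding l_def by linarith+
      ultimately have j_eq: "j = p + (k + 1) * i + l" using False by linarith
      have "i \<le> n div (k + 1)"
        unfolding i_def using j by (intro div_le_mono) auto
      then have last: "entry u (p + (k + 1) * i + k + 1) = entry v (p + (k + 1) * i + k + 1)"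
        by (intro eqA) (auto simp: A_def)
      show ?thesis
      proof (cases "l = k + 1")
        case True
        then show ?thesis using last j_eq by (simp add: algebra_simps)
      next
        case False
        then have "l \<in> {1..k}" using l by auto
        then show ?thesis
          using block_tailD[OF uv(1), of l i] block_tailD[OF uv(2), of l i] last j_eq by simp
      qed
    qed
  qed
  have "prefix n ` block_tail k p \<subseteq> (\<lambda>y. prefix n (inv_into (block_tail k p) h y)) ` h ` block_tail k p"
  proof
    fix x assume "x \<in> prefix n ` block_tail k p"
    then obtain w where w: "w \<in> block_tail k p" "x = prefix n w" by blast
    have "x = prefix n (inv_into (block_tail k p) h (h w))"
      unfolding w(2) using w(1) by (intro det inv_into_into) (auto simp: f_inv_into_f)
    then show "x \<in> (\<lambda>y. prefix n (inv_into (block_tail k p) h y)) ` h ` block_tail k p"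
      using w(1) by blast
  qed
  then have "card (prefix n ` block_tail k p) \<le> card (h ` block_tail k p)"
    using finh by (rule surj_card_le[rotated])
  also have "\<dots> \<le> card (A \<rightarrow>\<^sub>E {-1, 1::int})"
    using hS \<open>finite A\<close> by (intro card_mono) (auto intro: finite_PiE)
  also have "\<dots> = 2 ^ card A" using \<open>finite A\<close> by (simp add: card_PiE numeral_2_eq_2)
  also have "\<dots> \<le> 2 ^ (p + n div (k + 1) + 1)" using cardA by (intro power_increasing) auto
  finally show ?thesis .
qed

lemma card_prefixes_block_tails:
  assumes "S \<subseteq> (\<Union>p<P. block_tail k p)"
  shows "real (card (prefix n ` S)) \<le> real P * 2 ^ (P + 1) * 2 powr (1 / (real k + 1) * real n)"
proof -
  have "prefix n ` S \<subseteq> (\<Union>p<P. prefix n ` block_tail k p)" using assms by blast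
  then have "card (prefix n ` S) \<le> card (\<Union>p<P. prefix n ` block_tail k p)"
    by (intro card_mono finite_UN_I finite_prefixes) auto
  also have "\<dots> \<le> (\<Sum>p<P. card (prefix n ` block_tail k p))"
    by (rule card_UN_le) simp
  also have "\<dots> \<le> (\<Sum>p<P. 2 ^ (P + n div (k + 1) + 1))"
    by (intro sum_mono order_trans[OF card_prefixes_block_tail] power_increasing) auto
  also have "\<dots> = P * 2 ^ (P + 1) * 2 ^ (n div (k + 1))" by (simp add: power_add)
  finally have "real (card (prefix n ` S)) \<le> real (P * 2 ^ (P + 1) * 2 ^ (n div (k + 1)))"
    by (simp only: of_nat_le_iff)
  also have "\<dots> = real P * 2 ^ (P + 1) * 2 powr real (n div (k + 1))"
    by (simp add: powr_realpow)
  also have "\<dots> \<le> real P * 2 ^ (P + 1) * 2 powr (1 / (real k + 1) * real n)"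
    using of_nat_div_le_of_nat[of n "k + 1", where ?'a = real]
    by (intro mult_left_mono powr_mono) (auto simp: add.commute)
  finally show ?thesis .
qed

section \<open>Upper bounds from the growth of the number of prefixes\<close>

lemma two_over_power_powr: "(2 / 2 ^ n :: real) powr s = 2 powr s * 2 powr (- s * real n)"
  by (simp add: powr_divide powr_minus field_simps powr_powr flip: powr_realpow)

text \<open>
  A bound of order \<open>2 powr (D * n)\<close> for the number of cylinders of level \<open>n\<close> that meet \<open>S\<close>; these
  cylinders have diameter at most \<open>2 / 2 ^ n\<close>.
\<close>
locale prefix_growth =
  fixes S :: "sign_seq set" and K D :: real
  assumes card_prefixes_le: "\<And>n. real (card (prefix n ` S)) \<le> K * 2 powr (D * real n)"
    and D_nonneg: "0 \<le> D"
begin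

lemma K_nonneg: "0 \<le> K"
  using order_trans[OF of_nat_0_le_iff card_prefixes_le[of 0]] by simp

lemma covering_number_le:
  assumes "0 < \<delta>" "\<delta> \<le> 1"
  shows "\<exists>m. covering_number \<delta> S = enat m \<and> real m \<le> K * 4 powr D * \<delta> powr (- D)"
proof -
  obtain n where n: "1 / 2 ^ n \<le> \<delta>" "\<delta> < 2 / 2 ^ n" using dyadic_scale[OF assms] by blast
  let ?X = "prefix (Suc n) ` S"
  define C where "C = (\<lambda>x. {w \<in> S. prefix (Suc n) w = x}) ` ?X"
  have "small_set \<delta> {w \<in> S. prefix (Suc n) w = x}" for x
    using small_set_prefix_class[of "Suc n" S x] n(1) by (auto simp: small_set_def)
  then have "C \<in> {C. finite C \<and> S \<subseteq> \<Union>C \<and> (\<forall>U\<in>C. small_set \<delta> U)}"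
    unfolding C_def by (auto intro: finite_prefixes)
  then have "covering_number \<delta> S \<le> enat (card C)"
    unfolding covering_number_def by (rule INF_lower)
  then obtain m where m: "covering_number \<delta> S = enat m" "m \<le> card C"
    by (cases "covering_number \<delta> S") auto
  have "card C \<le> card ?X" unfolding C_def by (intro card_image_le finite_prefixes)
  with m(2) have "real m \<le> real (card ?X)" by simp
  also have "\<dots> \<le> K * 2 powr (D * real (Suc n))" by (rule card_prefixes_le)
  also have "2 powr (D * real (Suc n)) = (2 ^ Suc n) powr D"
    by (simp add: powr_powr mult.commute del: power_Suc of_nat_Suc flip: powr_realpow)
  also have "(2 ^ Suc n) powr D \<le> (4 / \<delta>) powr D"
    using n(2) assms D_nonneg by (intro powr_mono2) (auto simp: field_simps)
  also have "(4 / \<delta>) powr D = 4 powr D * \<delta> powr (- D)"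
    using assms by (simp add: powr_divide powr_minus_divide)
  finally show ?thesis using m(1) K_nonneg by (auto simp: mult_left_mono mult.assoc)
qed

lemma scaled_count_tendsto_0:
  assumes "D < s"
  shows "(\<lambda>n. K * 2 powr (D * real n) * (2 / 2 ^ n) powr s) \<longlonglongrightarrow> 0"
proof -
  have "K * 2 powr (D * real n) * (2 / 2 ^ n) powr s = K * 2 powr s * (2 powr (D - s)) ^ n" for n
  proof -
    have "(2 powr (D - s)) ^ n = (2::real) powr ((D - s) * real n)"
      by (simp add: powr_powr flip: powr_realpow)
    also have "\<dots> = 2 powr (D * real n) * 2 powr (- s * real n)"
      by (simp add: algebra_simps flip: powr_add)
    finally show ?thesis unfolding two_over_power_powr by simp
  qed
  moreover have "2 powr (D - s) < (1::real)" using assms powr_less_mono[of "D - s" 0 2] by simp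
  then have "(\<lambda>n. K * 2 powr s * (2 powr (D - s)) ^ n) \<longlonglongrightarrow> 0"
    by (intro tendsto_mult_right_zero LIMSEQ_power_zero) simp
  ultimately show ?thesis by (simp only:)
qed

lemma hausdorff_premeasure_le:
  assumes "0 < s" "2 / 2 ^ n \<le> \<delta>"
  shows "hausdorff_premeasure s \<delta> S \<le> ennreal (K * 2 powr (D * real n) * (2 / 2 ^ n) powr s)"
proof -
  let ?X = "prefix n ` S"
  obtain h where h: "bij_betw h {0..<card ?X} ?X"
    using ex_bij_betw_nat_finite[OF finite_prefixes] by blast
  define U where "U i = (if i < card ?X then {w \<in> S. prefix n w = h i} else {})" for i
  have small: "small_set (2 / 2 ^ n) (U i)" for i
    using small_set_prefix_class[of n S "h i"] small_set_prefix_class[of n "{}" "h i"]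
    unfolding U_def by auto
  have "S \<subseteq> (\<Union>i. U i)"
  proof
    fix w assume "w \<in> S"
    then have "prefix n w \<in> h ` {0..<card ?X}" using bij_betw_imp_surj_on[OF h] by blast
    then show "w \<in> (\<Union>i. U i)" using \<open>w \<in> S\<close> unfolding U_def by force
  qed
  moreover have "small_set \<delta> (U i)" for i using small[of i] assms(2) by (auto simp: small_set_def)
  ultimately have "hausdorff_premeasure s \<delta> S \<le> (\<Sum>i. diam_pow s (U i))"
    unfolding hausdorff_premeasure_def by (intro INF_lower) auto
  also have "\<dots> = (\<Sum>i<card ?X. diam_pow s (U i))"
    by (rule suminf_finite) (auto simp: U_def diam_pow_def)
  also have "\<dots> \<le> (\<Sum>i<card ?X. ennreal ((2 / 2 ^ n) powr s))"
  proof (rule sum_mono)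
    fix i
    have "bounded (U i)" "diameter (U i) \<le> 2 / 2 ^ n" using small[of i] by (auto simp: small_set_def)
    then have "diameter (U i) powr s \<le> (2 / 2 ^ n) powr s"
      using assms(1) by (intro powr_mono2 diameter_ge_0) auto
    then show "diam_pow s (U i) \<le> ennreal ((2 / 2 ^ n) powr s)"
      using assms(1) by (auto simp: diam_pow_def intro: ennreal_leI)
  qed
  also have "\<dots> = ennreal (real (card ?X) * (2 / 2 ^ n) powr s)"
    by (simp add: ennreal_mult ennreal_of_nat_eq_real_of_nat)
  also have "\<dots> \<le> ennreal (K * 2 powr (D * real n) * (2 / 2 ^ n) powr s)"
    by (intro ennreal_leI mult_right_mono card_prefixes_le) simp
  finally show ?thesis .
qed

lemma hausdorff_measure_zero:
  assumes "D < s"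
  shows "hausdorff_measure s S = 0"
proof -
  have "hausdorff_premeasure s \<delta> S \<le> 0" if "\<delta> > 0" for \<delta>
  proof (rule tendsto_lowerbound)
    show "(\<lambda>n. ennreal (K * 2 powr (D * real n) * (2 / 2 ^ n) powr s)) \<longlonglongrightarrow> 0"
      using tendsto_ennrealI[OF scaled_count_tendsto_0[OF assms]] by simp
    have "(\<lambda>n. 2 * (1 / 2 :: real) ^ n) \<longlonglongrightarrow> 0"
      by (intro tendsto_mult_right_zero LIMSEQ_power_zero) simp
    then have "\<forall>\<^sub>F n in sequentially. 2 * (1 / 2 :: real) ^ n < \<delta>"
      using that by (rule order_tendstoD)
    then show "\<forall>\<^sub>F n in sequentially. hausdorff_premeasure s \<delta> S \<le> ennreal (K * 2 powr (D * real n) * (2 / 2 ^ n) powr s)"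
    proof eventually_elim
      case (elim n)
      then show ?case
        using assms D_nonneg by (intro hausdorff_premeasure_le) (auto simp: power_one_over)
    qed
  qed simp
  then show ?thesis unfolding hausdorff_measure_def
    by (intro antisym SUP_least) auto
qed

text \<open>
  The balls are sorted by the dyadic order of magnitude of their radii.  The centres of disjoint
  balls with radius at least \<open>1 / 2 ^ n\<close> differ within their first \<open>n + 1\<close> signs, so the number of
  balls of order \<open>n\<close> is bounded by the prefix count, and the total is dominated by the tail of a
  geometric series with ratio \<open>2 powr (D - s) < 1\<close>.
\<close>
lemma sum_packing_le:
  assumes "D < s" and P: "is_packing (1 / 2 ^ m) S P" and F: "finite F" "F \<subseteq> P"
  shows "(\<Sum>(x, r)\<in>F. (2 * r) powr s)
    \<le> K * 2 powr D * 4 powr s * (2 powr (D - s)) ^ m / (1 - 2 powr (D - s))"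
proof -
  define q where "q = (2::real) powr (D - s)"
  have q: "0 < q" "q < 1" using assms(1) powr_less_mono[of "D - s" 0 2] by (auto simp: q_def)
  have radius: "0 < r" "r \<le> 1 / 2 ^ m" "x \<in> S" if "(x, r) \<in> F" for x r
    using P F(2) that by (auto simp: is_packing_def)
  have "\<forall>r\<in>snd ` F. \<exists>n. 1 / 2 ^ n \<le> r \<and> r < 2 / 2 ^ n"
  proof
    fix r assume "r \<in> snd ` F"
    then obtain x where "(x, r) \<in> F" by auto
    moreover have "1 / 2 ^ m \<le> (1 :: real)" by simp
    ultimately have "0 < r" "r \<le> 1" using radius(1,2)[of x r] by linarith+
    then show "\<exists>n. 1 / 2 ^ n \<le> r \<and> r < 2 / 2 ^ n" by (rule dyadic_scale)
  qed
  from bchoice[OF this] obtain lev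
    where "\<forall>r\<in>snd ` F. 1 / 2 ^ lev r \<le> r \<and> r < 2 / 2 ^ lev r" by blast
  then have lev: "1 / 2 ^ lev r \<le> r \<and> r < 2 / 2 ^ lev r" if "(x, r) \<in> F" for x r
    using that by force
  have lev_ge: "lev r \<ge> m" if "(x, r) \<in> F" for x r
  proof -
    have "1 / 2 ^ lev r \<le> (1 / 2 ^ m :: real)" using lev[OF that] radius(2)[OF that] by linarith
    then show ?thesis by (simp add: field_simps)
  qed
  define L where "L = (\<lambda>(x, r). lev r) ` F"
  have "finite L" unfolding L_def using F(1) by simp
  define G where "G n = {(x, r) \<in> F. lev r = n}" for n
  have card_G: "real (card (G n)) \<le> K * 2 powr (D * real (Suc n))" for n
  proof -
    have "inj_on (\<lambda>p. prefix (Suc n) (fst p)) (G n)"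
    proof (rule inj_onI, rule ccontr)
      fix p p' assume G: "p \<in> G n" "p' \<in> G n" and neq: "p \<noteq> p'"
        and eq: "prefix (Suc n) (fst p) = prefix (Suc n) (fst p')"
      obtain x r y t where p: "p = (x, r)" "p' = (y, t)" by (cases p, cases p')
      have F': "(x, r) \<in> F" "(y, t) \<in> F" "lev r = n" using G p by (auto simp: G_def)
      have "pairwise (\<lambda>(x, r) (y, t). disjnt (cball x r) (cball y t)) P"
        using P by (simp add: is_packing_def)
      from pairwiseD[OF this, of p p'] have "disjnt (cball x r) (cball y t)"
        using F' F(2) neq p by auto
      moreover have "y \<in> cball y t" using radius(1)[OF F'(2)] by simp
      moreover have "dist x y \<le> 2 / 2 ^ Suc n" using dist_le_if_prefix_eq[OF eq] p by simp
      then have "y \<in> cball x r" using lev[OF F'(1)] F'(3) by simp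
      ultimately show False by (auto simp: disjnt_def)
    qed
    then have "card (G n) = card ((\<lambda>p. prefix (Suc n) (fst p)) ` G n)" by (simp add: card_image)
    also have "\<dots> \<le> card (prefix (Suc n) ` S)"
    proof (intro card_mono finite_prefixes image_subsetI)
      fix p assume "p \<in> G n"
      then have "fst p \<in> S" using radius(3)[of "fst p" "snd p"] by (auto simp: G_def)
      then show "prefix (Suc n) (fst p) \<in> prefix (Suc n) ` S" by simp
    qed
    finally show ?thesis using card_prefixes_le[of "Suc n"] by linarith
  qed
  have "(\<Sum>(x, r)\<in>F. (2 * r) powr s) = (\<Sum>n\<in>L. \<Sum>(x, r)\<in>{p \<in> F. (\<lambda>(x, r). lev r) p = n}. (2 * r) powr s)"
    unfolding L_def by (rule sum.image_gen[OF F(1)])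
  also have "\<dots> = (\<Sum>n\<in>L. \<Sum>(x, r)\<in>G n. (2 * r) powr s)"
    by (intro sum.cong refl) (auto simp: G_def)
  also have "\<dots> \<le> (\<Sum>n\<in>L. K * 2 powr D * 4 powr s * q ^ n)"
  proof (rule sum_mono)
    fix n
    have "(\<Sum>(x, r)\<in>G n. (2 * r) powr s) \<le> (\<Sum>(x, r)\<in>G n. (4 / 2 ^ n) powr s)"
    proof (rule sum_mono, clarify)
      fix x r assume "(x, r) \<in> G n"
      then have "0 < r" "r < 2 / 2 ^ n" using lev[of x r] radius(1)[of x r] by (auto simp: G_def)
      then show "(2 * r) powr s \<le> (4 / 2 ^ n) powr s"
        using assms(1) D_nonneg by (intro powr_mono2) auto
    qed
    also have "\<dots> = real (card (G n)) * (4 / 2 ^ n) powr s" by (simp add: case_prod_beta)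
    also have "\<dots> \<le> K * 2 powr (D * real (Suc n)) * (4 / 2 ^ n) powr s"
      by (intro mult_right_mono card_G) simp
    also have "\<dots> = K * 2 powr D * 4 powr s * q ^ n"
    proof -
      have "(4 / 2 ^ n :: real) powr s = 4 powr s * 2 powr (- s * real n)"
        by (simp add: powr_divide powr_minus field_simps powr_powr flip: powr_realpow)
      moreover have "(2::real) powr (D * real (Suc n)) * 2 powr (- s * real n) = 2 powr D * q ^ n"
        unfolding q_def by (simp add: powr_powr algebra_simps flip: powr_realpow powr_add)
      ultimately show ?thesis by (simp add: algebra_simps)
    qed
    finally show "(\<Sum>(x, r)\<in>G n. (2 * r) powr s) \<le> K * 2 powr D * 4 powr s * q ^ n" .
  qed
  also have "\<dots> = K * 2 powr D * 4 powr s * (\<Sum>n\<in>L. q ^ n)"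
    by (rule sum_distrib_left[symmetric])
  also have "\<dots> \<le> K * 2 powr D * 4 powr s * (q ^ m / (1 - q))"
  proof (intro mult_left_mono)
    have "(\<Sum>n\<in>L. q ^ n) = (\<Sum>n\<in>(\<lambda>n. n - m) ` L. q ^ (n + m))"
      using lev_ge by (intro sum.reindex_bij_witness[of _ "\<lambda>n. n + m" "\<lambda>n. n - m"]) (auto simp: L_def)
    also have "\<dots> \<le> (\<Sum>n. q ^ (n + m))"
      using q \<open>finite L\<close> by (intro sum_le_suminf summable_ignore_initial_segment summable_geometric) auto
    also have "\<dots> = q ^ m / (1 - q)"
      using q by (simp add: power_add suminf_mult2[symmetric] suminf_geometric summable_geometric)
    finally show "(\<Sum>n\<in>L. q ^ n) \<le> q ^ m / (1 - q)" .
  qed (use K_nonneg in auto)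
  finally show ?thesis unfolding q_def by simp
qed

text \<open>
  The premeasure already vanishes, so the constant covering of \<open>S\<close> by itself serves in
  the infimum.
\<close>
lemma packing_measure_zero:
  assumes "D < s"
  shows "packing_measure s S = 0"
proof -
  define q where "q = (2::real) powr (D - s)"
  have q: "0 < q" "q < 1" using assms powr_less_mono[of "D - s" 0 2] by (auto simp: q_def)
  let ?c = "\<lambda>m. K * 2 powr D * 4 powr s * q ^ m / (1 - q)"
  have at: "packing_premeasure_at s (1 / 2 ^ m) S \<le> ennreal (?c m)" for m
    unfolding packing_premeasure_at_def
  proof (rule SUP_least, rule infsum_le_finite_sums)
    fix P F assume P: "P \<in> {P. is_packing (1 / 2 ^ m) S P}" and F: "finite F" "F \<subseteq> P"
    have "(\<Sum>(x, r)\<in>F. ennreal ((2 * r) powr s)) = ennreal (\<Sum>(x, r)\<in>F. (2 * r) powr s)"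
      by (simp add: case_prod_beta sum_ennreal)
    also have "\<dots> \<le> ennreal (?c m)"
      using sum_packing_le[OF assms _ F] P unfolding q_def by (intro ennreal_leI) simp
    finally show "(\<Sum>(x, r)\<in>F. ennreal ((2 * r) powr s)) \<le> ennreal (?c m)" .
  qed (rule nonneg_summable_on_complete, simp)
  have "packing_premeasure s S \<le> 0"
  proof (rule tendsto_lowerbound)
    have "?c \<longlonglongrightarrow> K * 2 powr D * 4 powr s * 0 / (1 - q)"
      using q by (intro tendsto_intros LIMSEQ_power_zero) auto
    then show "(\<lambda>m. ennreal (?c m)) \<longlonglongrightarrow> 0"
      using tendsto_ennrealI[of ?c 0] by simp
    have "packing_premeasure s S \<le> packing_premeasure_at s (1 / 2 ^ m) S" for m
      unfolding packing_premeasure_def by (rule INF_lower) simp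
    then show "\<forall>\<^sub>F m in sequentially. packing_premeasure s S \<le> ennreal (?c m)"
      by (intro always_eventually allI order_trans[OF _ at])
  qed simp
  then have "packing_premeasure s S = 0" by simp
  have "packing_measure s S \<le> (\<Sum>i::nat. packing_premeasure s S)"
    unfolding packing_measure_def by (rule INF_lower) auto
  then show ?thesis using \<open>packing_premeasure s S = 0\<close> by simp
qed

end

section \<open>Lower bounds from the binary coding of the unit interval\<close>

text \<open>
  The block sequence whose block number \<open>i\<close> (counted from \<open>0\<close>) ends with the binary digit number \<open>i + 1\<close> of
  \<open>x\<close>, the digits \<open>0\<close> and \<open>1\<close> being read as the signs \<open>-1\<close> and \<open>1\<close>.
\<close>
definition binary_code :: "nat \<Rightarrow> real \<Rightarrow> sign_seq" where
  "binary_code k x = Abs_sign_seq (restrict (\<lambda>n.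
     (if (k + 1) dvd n then 1 else -1) * (2 * (\<lfloor>2 ^ Suc ((n - 1) div (k + 1)) * x\<rfloor> mod 2) - 1)) {1..})"

lemma entry_binary_code:
  assumes "n \<ge> 1"
  shows "entry (binary_code k x) n =
    (if (k + 1) dvd n then 1 else -1) * (2 * (\<lfloor>2 ^ Suc ((n - 1) div (k + 1)) * x\<rfloor> mod 2) - 1)"
proof -
  have sign: "(if P then 1 else -1) * (2 * (b mod 2) - 1) \<in> {-1, 1::int}" for P b
  proof -
    have "b mod 2 = 0 \<or> b mod 2 = 1" by presburger
    then show ?thesis by auto
  qed
  show ?thesis
    unfolding binary_code_def using assms
    by (subst Abs_sign_seq_inverse)
      (simp_all only: restrict_PiE_iff atLeast_iff restrict_apply' sign simp_thms ball_triv)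
qed

lemma binary_code_in_block_tail: "binary_code k x \<in> block_tail k 0"
  unfolding block_tail_def
proof (intro CollectI allI ballI)
  fix i j assume j: "j \<in> {1..k}"
  have "((k + 1) * i + j - 1) div (k + 1) = i"
    using j by (intro div_nat_eqI) auto
  moreover have "((k + 1) * i + k) div (k + 1) = i"
    by (intro div_nat_eqI) auto
  moreover have "\<not> (k + 1) dvd (k + 1) * i + j"
  proof
    assume "(k + 1) dvd (k + 1) * i + j"
    then have "(k + 1) dvd j" by (simp only: dvd_add_right_iff[OF dvd_triv_left])
    then show False using j by (auto dest: dvd_imp_le)
  qed
  moreover have "(k + 1) dvd (k + 1) * i + k + 1"
    by (metis add.assoc dvd_add dvd_refl dvd_triv_left)
  ultimately show "entry (binary_code k x) (0 + (k + 1) * i + j)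
      = - entry (binary_code k x) (0 + (k + 1) * i + k + 1)"
    using j by (simp only: add_0 entry_binary_code if_True if_False add_diff_cancel_right' trans_le_add2 le_add2 atLeastAtMost_iff)
qed

lemma floor_double_div_2: "\<lfloor>2 * z\<rfloor> div 2 = \<lfloor>z :: real\<rfloor>"
proof -
  have "2 * (\<lfloor>2 * z\<rfloor> div 2) \<le> \<lfloor>2 * z\<rfloor>" "\<lfloor>2 * z\<rfloor> < 2 * (\<lfloor>2 * z\<rfloor> div 2) + 2" by presburger+
  then show ?thesis by (intro floor_unique[symmetric]) linarith+
qed

text \<open>
  The first \<open>n\<close> signs contain \<open>n div (k + 1)\<close> complete blocks, hence as many binary digits.
\<close>
lemma floor_eq_if_code_prefix_eq:
  assumes "x \<in> {0..<1}" "y \<in> {0..<1}" and eq: "prefix n (binary_code k x) = prefix n (binary_code k y)"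
  shows "m \<le> n div (k + 1) \<Longrightarrow> \<lfloor>2 ^ m * x\<rfloor> = \<lfloor>2 ^ m * y\<rfloor>"
proof (induction m)
  case 0
  have "\<lfloor>x\<rfloor> = 0" "\<lfloor>y\<rfloor> = 0" using assms(1,2) by (auto simp: floor_eq_iff)
  then show ?case by simp
next
  case (Suc m)
  let ?i = "(k + 1) * Suc m"
  have "?i \<le> (k + 1) * (n div (k + 1))" using Suc.prems by (intro mult_le_mono2)
  also have "\<dots> \<le> n" by (rule times_div_less_eq_dividend)
  finally have "?i \<in> {1..n}" by simp
  then have "entry (binary_code k x) ?i = entry (binary_code k y) ?i"
    using eq unfolding prefix_eq_iff by blast
  moreover have "(?i - 1) div (k + 1) = m" by (intro div_nat_eqI) auto
  moreover have "(k + 1) dvd ?i" by (rule dvd_triv_left)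
  moreover have "?i \<ge> 1" by simp
  ultimately have "\<lfloor>2 ^ Suc m * x\<rfloor> mod 2 = \<lfloor>2 ^ Suc m * y\<rfloor> mod 2"
    by (simp only: entry_binary_code if_True) simp
  moreover have "\<lfloor>2 ^ Suc m * x\<rfloor> div 2 = \<lfloor>2 ^ Suc m * y\<rfloor> div 2"
    using Suc floor_double_div_2[of "2 ^ m * x"] floor_double_div_2[of "2 ^ m * y"]
    by (simp add: mult.assoc)
  ultimately show ?case
    by (metis mult_div_mod_eq)
qed

lemma outer_measure_of_UN_le:
  assumes "\<And>i::nat. A i \<subseteq> space M"
  shows "outer_measure_of M (\<Union>i. A i) \<le> (\<Sum>i. outer_measure_of M (A i))"
proof -
  have "\<forall>i. \<exists>E\<in>sets M. A i \<subseteq> E \<and> outer_measure_of M (A i) = emeasure M E"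
    using outer_measure_of_attain[OF assms] by blast
  then obtain E where E: "\<And>i. E i \<in> sets M" "\<And>i. A i \<subseteq> E i" "\<And>i. outer_measure_of M (A i) = emeasure M (E i)"
    by metis
  have "outer_measure_of M (\<Union>i. A i) \<le> outer_measure_of M (\<Union>i. E i)"
    using E(2) by (intro outer_measure_of_mono) blast
  also have "\<dots> = emeasure M (\<Union>i. E i)" using E(1) by (intro outer_measure_of_eq) auto
  also have "\<dots> \<le> (\<Sum>i. emeasure M (E i))" using E(1) by (intro emeasure_subadditive_countably) auto
  finally show ?thesis by (simp only: E(3))
qed

text \<open>
  An outer version of the distribution of the random block sequence whose free signs are
  independent fair coins, realised through the binary digits of a uniform point.  Outer
  measure avoids all questions of measurability for the members of a covering.
\<close>
definition coin_mass :: "nat \<Rightarrow> sign_seq set \<Rightarrow> ennreal" where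
  "coin_mass k F = outer_measure_of lborel {x \<in> {0..<1}. binary_code k x \<in> F}"

lemma coin_mass_mono: "F \<subseteq> G \<Longrightarrow> coin_mass k F \<le> coin_mass k G"
  unfolding coin_mass_def by (intro outer_measure_of_mono) auto

lemma coin_mass_empty [simp]: "coin_mass k {} = 0"
  by (simp add: coin_mass_def)

lemma coin_mass_UN_le: "coin_mass k (\<Union>i::nat. F i) \<le> (\<Sum>i. coin_mass k (F i))"
proof -
  have "{x \<in> {0..<1::real}. binary_code k x \<in> (\<Union>i. F i)} = (\<Union>i. {x \<in> {0..<1}. binary_code k x \<in> F i})" by auto
  then show ?thesis unfolding coin_mass_def
    using outer_measure_of_UN_le[of "\<lambda>i. {x \<in> {0..<1::real}. binary_code k x \<in> F i}" lborel] by simp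
qed

lemma coin_mass_finite_Union_le:
  assumes "finite C"
  shows "coin_mass k (\<Union>C) \<le> (\<Sum>U\<in>C. coin_mass k U)"
proof -
  obtain h where h: "bij_betw h {0..<card C} C" using ex_bij_betw_nat_finite[OF assms] by blast
  define F where "F i = (if i < card C then h i else {})" for i
  have "\<Union>(h ` {0..<card C}) = (\<Union>i. F i)"
    unfolding F_def by (auto split: if_splits)
  then have "\<Union>C = (\<Union>i. F i)" by (simp only: bij_betw_imp_surj_on[OF h])
  then have "coin_mass k (\<Union>C) \<le> (\<Sum>i. coin_mass k (F i))" by (simp only: coin_mass_UN_le)
  also have "\<dots> = (\<Sum>i\<in>{0..<card C}. coin_mass k (F i))"
    by (rule suminf_finite) (auto simp: F_def)
  also have "\<dots> = (\<Sum>i\<in>{0..<card C}. coin_mass k (h i))" by (simp add: F_def)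
  also have "\<dots> = (\<Sum>U\<in>C. coin_mass k U)" by (rule sum.reindex_bij_betw[OF h])
  finally show ?thesis .
qed

lemma coin_mass_ge_1: "block_tail k 0 \<subseteq> F \<Longrightarrow> coin_mass k F \<ge> 1"
proof -
  assume "block_tail k 0 \<subseteq> F"
  then have "{x \<in> {0..<1::real}. binary_code k x \<in> F} = {0..<1}"
    using binary_code_in_block_tail by auto
  then show ?thesis unfolding coin_mass_def by simp
qed

text \<open>
  The points coded into one cylinder share \<open>m = n div (k + 1)\<close> binary digits and so lie in a dyadic
  interval of length \<open>1 / 2 ^ m\<close>; the factor \<open>2\<close> absorbs the rounding in \<open>m\<close>.
\<close>
lemma coin_mass_prefix_class_le:
  "coin_mass k {w. prefix n w = y} \<le> ennreal (2 * (1 / 2 ^ n) powr (1 / (real k + 1)))"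
proof (cases "{x \<in> {0..<1::real}. prefix n (binary_code k x) = y} = {}")
  case True
  then have "{x \<in> {0..<1::real}. binary_code k x \<in> {w. prefix n w = y}} = {}" by simp
  then show ?thesis unfolding coin_mass_def by (simp only:) simp
next
  case False
  then obtain x0 where x0: "x0 \<in> {0..<1::real}" "prefix n (binary_code k x0) = y" by auto
  define m where "m = n div (k + 1)"
  define j where "j = \<lfloor>2 ^ m * x0\<rfloor>"
  define J where "J = {of_int j / 2 ^ m ..< (of_int j + 1) / (2 ^ m :: real)}"
  have "{x \<in> {0..<1}. binary_code k x \<in> {w. prefix n w = y}} \<subseteq> J"
  proof clarify
    fix x :: real assume x: "x \<in> {0..<1}" "y = prefix n (binary_code k x)"
    then have "\<lfloor>2 ^ m * x\<rfloor> = j"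
      unfolding j_def m_def using x0 by (intro floor_eq_if_code_prefix_eq) auto
    then have "of_int j \<le> 2 ^ m * x" "2 ^ m * x < of_int j + 1" by (auto simp: floor_eq_iff)
    then show "x \<in> J" unfolding J_def by (auto simp: field_simps)
  qed
  then have "coin_mass k {w. prefix n w = y} \<le> outer_measure_of lborel J"
    unfolding coin_mass_def by (rule outer_measure_of_mono)
  also have "\<dots> = ennreal (1 / 2 ^ m)"
    unfolding J_def by (subst outer_measure_of_eq) (auto simp: field_simps simp flip: diff_divide_distrib)
  also have "\<dots> \<le> ennreal (2 * (1 / 2 ^ n) powr (1 / (real k + 1)))"
  proof (rule ennreal_leI)
    have "n = (k + 1) * m + n mod (k + 1)" unfolding m_def by (simp only: mult_div_mod_eq)
    moreover have "n mod (k + 1) < k + 1" by simp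
    ultimately have "n \<le> (k + 1) * (m + 1)" by (simp only: distrib_left mult_1_right)
    then have "real n \<le> real ((k + 1) * (m + 1))" by (simp only: of_nat_le_iff)
    then have "real n / (real k + 1) \<le> real m + 1" by (simp add: field_simps)
    then have "2 powr (- real m) \<le> (2 powr (1 - real n / (real k + 1)) :: real)"
      by (intro powr_mono) auto
    also have "\<dots> = 2 * (1 / 2 ^ n) powr (1 / (real k + 1))"
      by (simp add: powr_diff powr_divide powr_powr flip: powr_realpow)
    finally show "1 / 2 ^ m \<le> 2 * (1 / 2 ^ n) powr (1 / (real k + 1))"
      by (simp add: powr_minus_divide powr_realpow)
  qed
  finally show ?thesis .
qed

lemma coin_mass_small_set_le:
  assumes "small_set \<delta> U" "0 < \<delta>" "\<delta> \<le> 1"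
  shows "coin_mass k U \<le> ennreal (2 * \<delta> powr (1 / (real k + 1)))"
proof (cases "U = {}")
  case False
  then obtain u where u: "u \<in> U" by blast
  obtain n where n: "1 / 2 ^ n \<le> \<delta>" "\<delta> < 2 / 2 ^ n" using dyadic_scale[OF assms(2,3)] by blast
  have "coin_mass k U \<le> coin_mass k {w. prefix n w = prefix n u}"
    using small_set_subset_prefix_class[OF assms(1) n(2) _ u] by (intro coin_mass_mono) blast
  also have "\<dots> \<le> ennreal (2 * (1 / 2 ^ n) powr (1 / (real k + 1)))"
    by (rule coin_mass_prefix_class_le)
  also have "\<dots> \<le> ennreal (2 * \<delta> powr (1 / (real k + 1)))"
    using n(1) by (intro ennreal_leI mult_left_mono powr_mono2) auto
  finally show ?thesis .
qed simp

text \<open>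
  The form of the bound that suits coverings.  A set of diameter \<open>0\<close> needs separate
  treatment: for \<open>s > 0\<close> its mass vanishes because it is small at every scale.
\<close>
lemma coin_mass_le_diam_pow:
  assumes U: "small_set 1 U" and s: "0 \<le> s" "s \<le> 1 / (real k + 1)"
  shows "coin_mass k U \<le> 2 * diam_pow s U"
proof -
  let ?d = "diameter U"
  have small: "small_set \<delta> U" if "?d \<le> \<delta>" for \<delta> using U that by (simp add: small_set_def)
  have d: "0 \<le> ?d" "?d \<le> 1" using U by (auto simp: small_set_def intro: diameter_ge_0)
  consider "U = {}" | "U \<noteq> {}" "s = 0" | "U \<noteq> {}" "s > 0" "?d > 0" | "s > 0" "?d = 0"
    using s(1) d(1) by force
  then show ?thesis
  proof cases
    case 2
    then show ?thesis using coin_mass_small_set_le[OF U, of k] by (simp add: diam_pow_def)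
  next
    case 3
    have "coin_mass k U \<le> ennreal (2 * ?d powr (1 / (real k + 1)))"
      using 3 d by (intro coin_mass_small_set_le small) auto
    also have "\<dots> \<le> ennreal (2 * ?d powr s)"
      using 3 d s by (intro ennreal_leI mult_left_mono powr_mono') auto
    also have "\<dots> = 2 * diam_pow s U" using 3 by (simp add: diam_pow_def ennreal_mult)
    finally show ?thesis .
  next
    case 4
    define q where "q = (1 / 2 :: real) powr (1 / (real k + 1))"
    have "coin_mass k U \<le> ennreal (2 * q ^ n)" for n
    proof -
      have "coin_mass k U \<le> ennreal (2 * (1 / 2 ^ n) powr (1 / (real k + 1)))"
        using 4 by (intro coin_mass_small_set_le small) auto
      also have "(1 / 2 ^ n) powr (1 / (real k + 1)) = ((1 / 2) ^ n) powr (1 / (real k + 1))"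
        by (simp only: power_one_over)
      also have "\<dots> = q ^ n"
        unfolding q_def by (induction n) (simp_all only: power_0 power_Suc powr_one_eq_one powr_mult)
      finally show ?thesis .
    qed
    moreover have "0 \<le> q" "q < 1"
      unfolding q_def using powr_less_mono2[of "1 / (real k + 1)" "1 / 2" 1] by auto
    then have "(\<lambda>n. 2 * q ^ n) \<longlonglongrightarrow> 0" by (intro tendsto_mult_right_zero LIMSEQ_power_zero) simp
    then have "(\<lambda>n. ennreal (2 * q ^ n)) \<longlonglongrightarrow> 0" using tendsto_ennrealI[of "\<lambda>n. 2 * q ^ n" 0] by simp
    ultimately have "coin_mass k U \<le> 0"
      by (intro tendsto_lowerbound[of _ 0 sequentially]) auto
    then show ?thesis by simp
  qed simp
qed

lemma ennreal_half_pos: "0 < ennreal (1 / 2)"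
  using ennreal_lessI[of "1 / 2" 0] by (simp only: ennreal_0)

lemma double_less_1_if_less_half:
  assumes "X < ennreal (1 / 2)"
  shows "2 * X < 1"
proof (cases X)
  case (real x)
  then have "x < 1 / 2" using assms ennreal_leI[of "1 / 2" x] by (meson leD not_le_imp_less)
  then have "ennreal (2 * x) < ennreal 1" by (intro ennreal_lessI) auto
  then show ?thesis using real by (simp add: ennreal_mult)
next
  case top
  then show ?thesis using assms by (meson not_top_less)
qed

context
  fixes k :: nat and S :: "sign_seq set"
  assumes blocks: "block_tail k 0 \<subseteq> S"
begin

text \<open>
  The mass distribution principle: a covering of \<open>S\<close> carries total mass at least \<open>1\<close>, and a member
  of it carries at most twice its contribution to the premeasure.
\<close>
lemma hausdorff_measure_nonzero:
  assumes s: "0 \<le> s" "s \<le> 1 / (real k + 1)"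
  shows "hausdorff_measure s S \<noteq> 0"
proof
  assume "hausdorff_measure s S = 0"
  moreover have "hausdorff_premeasure s 1 S \<le> hausdorff_measure s S"
    unfolding hausdorff_measure_def by (rule SUP_upper) simp
  ultimately have "hausdorff_premeasure s 1 S < ennreal (1 / 2)"
    using ennreal_half_pos by (simp only: le_zero_eq)
  then obtain U where U: "S \<subseteq> (\<Union>i. U i)" "\<And>i. small_set 1 (U i)"
    and sum: "(\<Sum>i. diam_pow s (U i)) < ennreal (1 / 2)"
    unfolding hausdorff_premeasure_def INF_less_iff by blast
  have "1 \<le> coin_mass k (\<Union>i. U i)" using blocks U(1) by (intro coin_mass_ge_1) blast
  also have "\<dots> \<le> (\<Sum>i. coin_mass k (U i))" by (rule coin_mass_UN_le)
  also have "\<dots> \<le> (\<Sum>i. 2 * diam_pow s (U i))"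
    by (intro suminf_le coin_mass_le_diam_pow U(2) s) auto
  also have "\<dots> = 2 * (\<Sum>i. diam_pow s (U i))" by simp
  also have "\<dots> < 1" using sum by (rule double_less_1_if_less_half)
  finally show False by simp
qed

lemma covering_number_ge:
  assumes "covering_number \<delta> S = enat m" "0 < \<delta>" "\<delta> \<le> 1"
  shows "1 / 2 * \<delta> powr (- (1 / (real k + 1))) \<le> real m"
proof -
  let ?Cs = "{C. finite C \<and> S \<subseteq> \<Union>C \<and> (\<forall>U\<in>C. small_set \<delta> U)}"
  let ?D = "1 / (real k + 1)"
  have "?Cs \<noteq> {}"
  proof
    assume "?Cs = {}"
    then have "covering_number \<delta> S = (INF C\<in>{} :: sign_seq set set set. enat (card C))"
      unfolding covering_number_def by (simp only:)
    then show False using assms(1) by (simp add: top_enat_def)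
  qed
  then obtain C0 where "C0 \<in> ?Cs" by blast
  then have "covering_number \<delta> S \<in> (\<lambda>C. enat (card C)) ` ?Cs"
    unfolding covering_number_def by (intro wellorder_InfI[OF imageI])
  then obtain C where "C \<in> ?Cs" "enat m = enat (card C)"
    unfolding assms(1) by (rule imageE)
  then have C: "finite C" "S \<subseteq> \<Union>C" "\<And>U. U \<in> C \<Longrightarrow> small_set \<delta> U" "m = card C"
    by simp_all
  have "1 \<le> coin_mass k (\<Union>C)" using blocks C(2) by (intro coin_mass_ge_1) blast
  also have "\<dots> \<le> (\<Sum>U\<in>C. coin_mass k U)" by (rule coin_mass_finite_Union_le[OF C(1)])
  also have "\<dots> \<le> (\<Sum>U\<in>C. ennreal (2 * \<delta> powr ?D))"
    by (intro sum_mono coin_mass_small_set_le C(3) assms)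
  also have "\<dots> = ennreal (real m * (2 * \<delta> powr ?D))"
    using C(4) by (simp add: ennreal_mult ennreal_of_nat_eq_real_of_nat)
  finally have "1 \<le> real m * (2 * \<delta> powr ?D)" by simp
  then show ?thesis
    using assms(2) by (simp add: powr_minus_divide field_simps)
qed

end

text \<open>
  One point is chosen from each cylinder of level \<open>n\<close> that meets \<open>F\<close>.  Such points are at distance at least
  \<open>2 / 2 ^ n\<close>, so closed balls of radius \<open>r = 1 / 2 / 2 ^ n\<close> around them form a packing, each
  contributing \<open>(2 * r) powr s = (1 / 2 ^ n) powr s\<close>.  The same cylinders cover \<open>F\<close>, and each has mass at most
  twice this contribution.
\<close>
lemma coin_mass_le_packing_premeasure_at:
  assumes s: "0 \<le> s" "s \<le> 1 / (real k + 1)" and \<delta>: "0 < \<delta>"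
  shows "coin_mass k F \<le> 2 * packing_premeasure_at s \<delta> F"
proof -
  obtain n where "(1 / 2) ^ n < \<delta>" using real_arch_pow_inv[of \<delta> "1 / 2"] \<delta> by auto
  then have n: "1 / 2 ^ n < \<delta>" by (simp add: power_one_over)
  let ?X = "prefix n ` F"
  define pt where "pt = inv_into F (prefix n)"
  have pt: "pt x \<in> F" "prefix n (pt x) = x" if "x \<in> ?X" for x
    using that unfolding pt_def by (auto intro: inv_into_into f_inv_into_f)
  define r :: real where "r = 1 / 2 / 2 ^ n"
  define P where "P = (\<lambda>x. (pt x, r)) ` ?X"
  have inj: "inj_on (\<lambda>x. (pt x, r)) ?X"
    by (intro inj_onI) (metis pt(2) prod.inject)
  have "0 < r" "r \<le> \<delta>" unfolding r_def using n by (auto simp: field_simps)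
  have sep: "disjnt (cball (pt x) r) (cball (pt y) r)" if "x \<in> ?X" "y \<in> ?X" "x \<noteq> y" for x y
  proof -
    have "\<not> dist (pt x) (pt y) < 2 / 2 ^ n"
      using prefix_eq_if_dist_less[of "pt x" "pt y" n] pt(2) that by auto
    then have far: "dist (pt x) (pt y) > r + r" unfolding r_def by (simp add: field_simps)
    show ?thesis
      unfolding disjnt_iff
    proof (intro allI notI)
      fix z assume "z \<in> cball (pt x) r \<and> z \<in> cball (pt y) r"
      then show False using far dist_triangle2[of "pt x" "pt y" z] by simp
    qed
  qed
  have "countable P" unfolding P_def by (intro countable_finite finite_imageI finite_prefixes)
  moreover have "P \<subseteq> F \<times> {0<..\<delta>}"
    unfolding P_def using pt(1) \<open>0 < r\<close> \<open>r \<le> \<delta>\<close> by auto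
  moreover have "pairwise (\<lambda>(x, r) (y, t). disjnt (cball x r) (cball y t)) P"
  proof (rule pairwiseI)
    fix p p' assume p: "p \<in> P" "p' \<in> P" "p \<noteq> p'"
    obtain x where x: "p = (pt x, r)" "x \<in> ?X" using p(1) unfolding P_def by (rule imageE)
    obtain y where y: "p' = (pt y, r)" "y \<in> ?X" using p(2) unfolding P_def by (rule imageE)
    have "x \<noteq> y" using p(3) x(1) y(1) by auto
    then have "disjnt (cball (pt x) r) (cball (pt y) r)" by (rule sep[OF x(2) y(2)])
    then show "(\<lambda>(x, r) (y, t). disjnt (cball x r) (cball y t)) p p'"
      unfolding x(1) y(1) by simp
  qed
  ultimately have "is_packing \<delta> F P" unfolding is_packing_def by blast
  then have "(\<Sum>\<^sub>\<infinity>(x, r)\<in>P. ennreal ((2 * r) powr s)) \<le> packing_premeasure_at s \<delta> F"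
    unfolding packing_premeasure_at_def by (intro SUP_upper) simp
  moreover have "(\<Sum>\<^sub>\<infinity>(x, r)\<in>P. ennreal ((2 * r) powr s)) = (\<Sum>(x, r)\<in>P. ennreal ((2 * r) powr s))"
    unfolding P_def by (intro infsum_finite finite_imageI finite_prefixes)
  moreover have "\<dots> = (\<Sum>x\<in>?X. ennreal ((1 / 2 ^ n) powr s))"
    unfolding P_def by (subst sum.reindex[OF inj]) (simp add: r_def)
  ultimately have count: "(\<Sum>x\<in>?X. ennreal ((1 / 2 ^ n) powr s)) \<le> packing_premeasure_at s \<delta> F"
    by (simp only:)
  have "coin_mass k F \<le> coin_mass k (\<Union>((\<lambda>x. {w. prefix n w = x}) ` ?X))"
    by (intro coin_mass_mono) blast
  also have "\<dots> \<le> (\<Sum>U\<in>(\<lambda>x. {w. prefix n w = x}) ` ?X. coin_mass k U)"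
    by (intro coin_mass_finite_Union_le finite_imageI finite_prefixes)
  also have "\<dots> = (\<Sum>x\<in>?X. coin_mass k {w. prefix n w = x})"
  proof (rule sum.reindex_cong[OF _ refl refl])
    show "inj_on (\<lambda>x. {w. prefix n w = x}) ?X" by (rule inj_onI) blast
  qed
  also have "\<dots> \<le> (\<Sum>x\<in>?X. 2 * ennreal ((1 / 2 ^ n) powr s))"
  proof (rule sum_mono)
    fix x
    have "coin_mass k {w. prefix n w = x} \<le> ennreal (2 * (1 / 2 ^ n) powr (1 / (real k + 1)))"
      by (rule coin_mass_prefix_class_le)
    also have "\<dots> \<le> ennreal (2 * (1 / 2 ^ n) powr s)"
      using s by (intro ennreal_leI mult_left_mono powr_mono') auto
    finally show "coin_mass k {w. prefix n w = x} \<le> 2 * ennreal ((1 / 2 ^ n) powr s)"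
      by (simp add: ennreal_mult)
  qed
  also have "\<dots> = 2 * (\<Sum>x\<in>?X. ennreal ((1 / 2 ^ n) powr s))" by (rule sum_distrib_left[symmetric])
  also have "\<dots> \<le> 2 * packing_premeasure_at s \<delta> F" using count by (intro mult_left_mono) auto
  finally show ?thesis .
qed

text \<open>
  The comparison with the mass holds for arbitrary sets, so it applies to each member of a
  decomposition of \<open>S\<close>; countable subadditivity of the mass does the rest.
\<close>
lemma packing_measure_nonzero:
  assumes blocks: "block_tail k 0 \<subseteq> S" and s: "0 \<le> s" "s \<le> 1 / (real k + 1)"
  shows "packing_measure s S \<noteq> 0"
proof
  assume "packing_measure s S = 0"
  then have "packing_measure s S < ennreal (1 / 2)"
    using ennreal_half_pos by (simp only:)
  then obtain F where F: "S \<subseteq> (\<Union>i. F i)" "(\<Sum>i. packing_premeasure s (F i)) < ennreal (1 / 2)"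
    unfolding packing_measure_def INF_less_iff by blast
  have "coin_mass k (F i) \<le> 2 * packing_premeasure s (F i)" for i
  proof -
    have "coin_mass k (F i) / 2 \<le> packing_premeasure s (F i)"
      unfolding packing_premeasure_def
      by (intro INF_greatest divide_le_posI_ennreal coin_mass_le_packing_premeasure_at s) auto
    then have "2 * (coin_mass k (F i) / 2) \<le> 2 * packing_premeasure s (F i)"
      by (intro mult_left_mono) auto
    then show ?thesis by (simp add: ennreal_times_divide mult_divide_eq_ennreal mult.commute[of 2 "coin_mass k (F i)"])
  qed
  then have "(\<Sum>i. coin_mass k (F i)) \<le> (\<Sum>i. 2 * packing_premeasure s (F i))"
    by (intro suminf_le) auto
  moreover have "1 \<le> coin_mass k (\<Union>i. F i)" using blocks F(1) by (intro coin_mass_ge_1) blast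
  moreover have "coin_mass k (\<Union>i. F i) \<le> (\<Sum>i. coin_mass k (F i))" by (rule coin_mass_UN_le)
  ultimately have "1 \<le> 2 * (\<Sum>i. packing_premeasure s (F i))" by simp
  also have "\<dots> < 1" using F(2) by (rule double_less_1_if_less_half)
  finally show False by simp
qed

section \<open>The three dimensions\<close>

lemma Inf_ereal_threshold:
  assumes "0 \<le> D" and above: "\<And>s. D < s \<Longrightarrow> P s"
    and below: "\<And>s. 0 \<le> s \<Longrightarrow> s \<le> D \<Longrightarrow> \<not> P s"
  shows "Inf {ereal s |s. 0 \<le> s \<and> P s} = ereal D"
proof (rule antisym)
  show "ereal D \<le> Inf {ereal s |s. 0 \<le> s \<and> P s}"
    using below by (intro Inf_greatest) force
  show "Inf {ereal s |s. 0 \<le> s \<and> P s} \<le> ereal D"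
  proof (rule ereal_le_epsilon2)
    fix e :: real assume "e > 0"
    then show "Inf {ereal s |s. 0 \<le> s \<and> P s} \<le> ereal D + ereal e"
      using above[of "D + e"] assms(1) by (intro Inf_lower) auto
  qed
qed

text \<open>
  The multiplicative constants change the ratio only by \<open>ln c / (- ln \<delta>)\<close> and \<open>ln C / (- ln \<delta>)\<close>,
  which tend to \<open>0\<close>.
\<close>
lemma has_box_dimI:
  assumes "0 < c" "0 < C"
    and bounds: "\<And>\<delta>. 0 < \<delta> \<Longrightarrow> \<delta> < 1 \<Longrightarrow> \<exists>m. covering_number \<delta> E = enat m
      \<and> c * \<delta> powr (- D) \<le> real m \<and> real m \<le> C * \<delta> powr (- D)"
  shows "has_box_dim E (ereal D)"
proof -
  define ratio where "ratio \<delta> = real_of_ereal (box_ratio E \<delta>)" for \<delta>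
  have ratio: "box_ratio E \<delta> = ereal (ratio \<delta>) \<and>
      D + ln c / (- ln \<delta>) \<le> ratio \<delta> \<and> ratio \<delta> \<le> D + ln C / (- ln \<delta>)"
    if \<delta>: "0 < \<delta>" "\<delta> < 1" for \<delta>
  proof -
    obtain m where m: "covering_number \<delta> E = enat m"
      "c * \<delta> powr (- D) \<le> real m" "real m \<le> C * \<delta> powr (- D)"
      using bounds[OF \<delta>] by blast
    obtain L where L: "ln \<delta> = - L" "L > 0" using \<delta> by (intro that[of "- ln \<delta>"]) auto
    have "0 < c * \<delta> powr (- D)" using assms(1) \<delta> by simp
    then have "0 < real m" using m(2) by linarith
    have ratio: "box_ratio E \<delta> = ereal (ln (real m) / L)"
      unfolding box_ratio_def m(1) L(1) using L(2) by simp
    have "ln (c * \<delta> powr (- D)) \<le> ln (real m)"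
      using m(2) \<open>0 < c * \<delta> powr (- D)\<close> \<open>0 < real m\<close> by simp
    then have lower: "ln c + D * L \<le> ln (real m)"
      using assms(1) \<delta> L(1) by (simp add: ln_mult ln_powr)
    have "ln (real m) \<le> ln (C * \<delta> powr (- D))"
      using m(3) \<open>0 < real m\<close> by simp
    then have upper: "ln (real m) \<le> ln C + D * L"
      using assms(2) \<delta> L(1) by (simp add: ln_mult ln_powr)
    have eq: "D + a / L = (a + D * L) / L" for a
      using L(2) by (simp add: add_divide_distrib)
    have "D + ln c / L \<le> ln (real m) / L" "ln (real m) / L \<le> D + ln C / L"
      unfolding eq using lower upper L(2) by (auto intro: divide_right_mono)
    then show ?thesis
      using ratio unfolding ratio_def L(1) by simp
  qed
  have ev: "\<forall>\<^sub>F \<delta> in at_right 0. 0 < \<delta> \<and> \<delta> < (1::real)"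
    unfolding eventually_at_right_field by (intro exI[of _ 1]) auto
  have lim: "((\<lambda>\<delta>. D + a / (- ln \<delta>)) \<longlongrightarrow> D) (at_right 0)" for a :: real
  proof -
    have "filterlim (\<lambda>\<delta>. - ln \<delta> :: real) at_top (at_right 0)"
      using ln_at_0 by (simp add: filterlim_uminus_at_bot)
    then have "((\<lambda>\<delta>. a / (- ln \<delta>)) \<longlongrightarrow> 0) (at_right 0)"
      by (intro tendsto_divide_0[OF tendsto_const] filterlim_at_top_imp_at_infinity)
    from tendsto_add[OF tendsto_const[of D] this] show ?thesis by simp
  qed
  have "(ratio \<longlongrightarrow> D) (at_right 0)"
    by (rule tendsto_sandwich[OF _ _ lim lim]; rule eventually_mono[OF ev]) (use ratio in auto)
  then have "((\<lambda>\<delta>. ereal (ratio \<delta>)) \<longlongrightarrow> ereal D) (at_right 0)" by (rule tendsto_ereal)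
  moreover have "\<forall>\<^sub>F \<delta> in at_right 0. ereal (ratio \<delta>) = box_ratio E \<delta>"
    using ev by eventually_elim (use ratio in auto)
  ultimately have "(box_ratio E \<longlongrightarrow> ereal D) (at_right 0)"
    by (rule Lim_transform_eventually)
  then show ?thesis
    unfolding has_box_dim_def lower_box_dim_def upper_box_dim_def
    by (intro conjI lim_imp_Liminf lim_imp_Limsup) auto
qed

theorem theorem1p2:
  fixes k :: nat and f :: "nat \<Rightarrow> int"
  assumes "k \<ge> 2"
    and "f 0 = 0"
    and "\<And>n. n \<ge> k + 1 \<Longrightarrow> f n = (\<Sum>j=1..k. f (n - j))"
    and "\<And>n (e :: nat \<Rightarrow> int). 1 \<le> n \<Longrightarrow> n \<le> k \<Longrightarrow> (\<forall>j\<in>{1..n}. e j \<in> {-1, 1})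
           \<Longrightarrow> (\<Sum>j=1..n. e j * f j) \<noteq> 0"
  shows "hausdorff_dim (zero_return_set f) = ereal (1 / (real k + 1))
       \<and> packing_dim (zero_return_set f) = ereal (1 / (real k + 1))
       \<and> has_box_dim (zero_return_set f) (ereal (1 / (real k + 1)))"
proof -
  let ?N = "zero_return_set f" and ?D = "1 / (real k + 1)"
  have f: "kbonacci k f"
    unfolding kbonacci_def using assms(3) by (simp add: sum.atLeast1_atMost_eq)
  have "f 1 \<noteq> 0"
    using assms(4)[of 1 "\<lambda>_. 1"] assms(1) by simp
  then obtain P where P: "?N \<subseteq> (\<Union>p<P. block_tail k p)"
    using zero_return_set_subset_block_tails[OF assms(1) f] by blast
  have blocks: "block_tail k 0 \<subseteq> ?N"
    by (rule block_tail_0_subset_zero_return_set[OF f])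
  define K where "K = real P * 2 ^ (P + 1)"
  interpret prefix_growth ?N K ?D
    using card_prefixes_block_tails[OF P] unfolding K_def by unfold_locales simp_all
  have "hausdorff_dim ?N = ereal ?D"
    unfolding hausdorff_dim_def
    by (rule Inf_ereal_threshold)
      (use D_nonneg hausdorff_measure_zero hausdorff_measure_nonzero[OF blocks] in auto)
  moreover have "packing_dim ?N = ereal ?D"
    unfolding packing_dim_def
    by (rule Inf_ereal_threshold)
      (use D_nonneg packing_measure_zero packing_measure_nonzero[OF blocks] in auto)
  moreover have "has_box_dim ?N (ereal ?D)"
  proof (rule has_box_dimI)
    fix \<delta> :: real assume \<delta>: "0 < \<delta>" "\<delta> < 1"
    then obtain m where m: "covering_number \<delta> ?N = enat m" "real m \<le> K * 4 powr ?D * \<delta> powr (- ?D)"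
      using covering_number_le[of \<delta>] by auto
    have "1 / 2 * \<delta> powr (- ?D) \<le> real m"
      using \<delta> by (intro covering_number_ge[OF blocks m(1)]) auto
    moreover have "K * 4 powr ?D * \<delta> powr (- ?D) \<le> (K * 4 powr ?D + 1) * \<delta> powr (- ?D)"
      by (intro mult_right_mono) auto
    ultimately show "\<exists>m. covering_number \<delta> ?N = enat m \<and> 1 / 2 * \<delta> powr (- ?D) \<le> real m
        \<and> real m \<le> (K * 4 powr ?D + 1) * \<delta> powr (- ?D)"
      using m by (intro exI[of _ m] conjI) linarith+
  qed (use K_nonneg in \<open>auto intro: add_nonneg_pos\<close>)
  ultimately show ?thesis by blast
qed

end
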